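(* Let $Q$ be the function which assigns to a chord diagram $C$ the polynomial $$Q(C)=\sum_{P\in\mathcal P(G(C))}\Big(\prod_{v\in V(G(C))} w(P_v)\Big)\,x^{c(P)-1}\in\mathbb C[s,t,x],$$ where $G(C)$ is the $4$-regular graph of $C$ with its distinguished oriented Euler circuit, the sum is over all circuit partitions $P$ of $G(C)$, $P_v$ is the transition of $P$ at the vertex $v$, $c(P)$ is the number of circles of $P$, and the weight $w$ of a transition is $s$ if it is of type $\phi$, $t$ if it is of type $\psi$, and $-t$ if it is of type $\chi$ with respect to the distinguished Euler circuit. Then $Q$ is a multiplicative weight system; that is, $Q$ satisfies all $4$-term relations for chord diagrams, and $Q(C_1C_2)=Q(C_1)Q(C_2)$ for all chord diagrams $C_1,C_2$ and any product $C_1C_2$ of them.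
   Context: A chord diagram of order $n$ is an oriented circle with $2n$ distinct points on it, split into $n$ disjoint pairs (chords), considered up to orientation preserving diffeomorphisms of the circle. $4$-term relations. Let $C$ be a chord diagram and let $a\neq b$ be two chords having neighboring ends: an end $A$ of $a$ and an end $B_1$ of $b$ with no other chord ends on the arc between them. Let $B_2$ be the other end of $b$. Define $C'_{ab}$ as the diagram obtained by exchanging the neighboring ends $A$ and $B_1$; define $\widetilde C_{ab}$ as the diagram obtained by moving the end $A$ along $b$ to a position neighboring $B_2$: if in $C$ the end $A$ immediately precedes $B_1$ (with respect to the orientation of the circle), then in $\widetilde C_{ab}$ it immediately follows $B_2$, and if in $C$ it immediately follows $B_1$, then in $\widetilde C_{ab}$ it immediately precedes $B_2$; define $\widetilde C'_{ab}$ as the diagram obtained from $\widetilde C_{ab}$ by exchanging the neighboring ends $A$ and $B_2$. All other chord ends are unchanged. The $4$-term relation for a function $f$ with values in a commutative ring is $f(C)-f(C'_{ab})-f(\widetilde C_{ab})+f(\widetilde C'_{ab})=0$. A function on chord diagrams with values in a commutative ring is a weight system if it satisfies all $4$-term relations. Product. A product of chord diagrams $C_1$ and $C_2$ is obtained by cutting the supporting circle of each at an arbitrary point different from the ends of the chords and gluing the resulting arcs together, in an orientation-preserving way, into one new circle. (Modulo $4$-term relations the result does not depend on the cutting points.) The graph $G(C)$. Contracting each chord of $C$ to a vertex gives a $4$-regular graph $G(C)$: its vertices are the chords of $C$, its edges are the arcs of the circle between consecutive chord ends, and the oriented supporting circle becomes a distinguished oriented Euler circuit in $G(C)$. (For the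 diagram with no chords, $G(C)$ is a circle without vertices, which has a single circuit partition, consisting of one circle.) At each vertex $v$ there are four half-edges, two entering $v$ and two leaving $v$ along the Euler circuit. A transition at $v$ is a splitting of these four half-edges into two disjoint pairs; there are three of them. Pick a half-edge $h$ entering $v$. The transition is of type $\phi$ if $h$ is paired with the leaving half-edge immediately following $h$ along the Euler circuit; of type $\chi$ if $h$ is paired with the other leaving half-edge; of type $\psi$ if $h$ is paired with the other entering half-edge. (The type does not depend on the choice of $h$.) A circuit partition $P$ is a choice of one transition at each vertex; $\mathcal P(G)$ is the set of circuit partitions of $G$. Erasing all vertices and gluing the free ends of half-edges paired by the transitions of $P$ gives a disjoint family of circles, whose number is $c(P)$. *)

theory Defs
  imports
    "HOL-Computational_Algebra.Polynomial"
    "HOL-Library.FuncSet"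
    "HOL-Library.Disjoint_Sets"
begin

text \<open>
  A chord diagram is encoded by a word listing the names of the chords met along the oriented
  circle, starting from an arbitrary cut point that is not a chord end. Every chord has two ends,
  so every letter that occurs does so exactly twice. Diagrams are considered up to the choice of
  the cut point (rotation of the word) and the naming of the chords.
\<close>

definition chord_diagram :: "nat list \<Rightarrow> bool" where
  "chord_diagram C \<longleftrightarrow> (\<forall>a \<in> set C. count_list C a = 2)"

definition diagram_iso :: "nat list \<Rightarrow> nat list \<Rightarrow> bool" where
  "diagram_iso C D \<longleftrightarrow> (\<exists>k f. inj_on f (set C) \<and> D = map f (rotate k C))"

text \<open>
  In \<open>four_term C C' D D'\<close> the four words are $C$, $C'_{ab}$, $\widetilde C_{ab}$ and
  $\widetilde C'_{ab}$. The circle is cut immediately before the two neighbouring ends, so that the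
  exhibited first \<open>b\<close> is the end $B_1$, the exhibited second \<open>b\<close> is $B_2$, and the exhibited \<open>a\<close> is
  the moving end $A$; the other end of the chord \<open>a\<close> lies in \<open>u\<close> or in \<open>v\<close>. The two rules are the
  cases in which $A$ precedes or follows $B_1$ in $C$.
\<close>

inductive four_term :: "nat list \<Rightarrow> nat list \<Rightarrow> nat list \<Rightarrow> nat list \<Rightarrow> bool" where
  precedes: "a \<noteq> b \<Longrightarrow> chord_diagram ([a, b] @ u @ [b] @ v) \<Longrightarrow>
    four_term ([a, b] @ u @ [b] @ v) ([b, a] @ u @ [b] @ v)
              ([b] @ u @ [b, a] @ v) ([b] @ u @ [a, b] @ v)"
| follows: "a \<noteq> b \<Longrightarrow> chord_diagram ([b, a] @ u @ [b] @ v) \<Longrightarrow>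
    four_term ([b, a] @ u @ [b] @ v) ([a, b] @ u @ [b] @ v)
              ([b] @ u @ [a, b] @ v) ([b] @ u @ [b, a] @ v)"

text \<open>
  The first conjunct says that \<open>f\<close> is a function of chord diagrams and not just of the words
  representing them; together with it, having the four-term relations only for the cut points
  chosen in \<open>four_term\<close> is no restriction.
\<close>

definition weight_system :: "(nat list \<Rightarrow> 'r::comm_ring) \<Rightarrow> bool" where
  "weight_system f \<longleftrightarrow>
     (\<forall>C D. chord_diagram C \<and> diagram_iso C D \<longrightarrow> f C = f D) \<and>
     (\<forall>C C' D D'. four_term C C' D D' \<longrightarrow> f C - f C' - f D + f D' = 0)"

text \<open>
  Up to isomorphism a diagram has many products, depending on the points at which the two circles
  are cut: all words \<open>u\<close> and \<open>v\<close> representing the factors are allowed.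
\<close>

definition is_product :: "nat list \<Rightarrow> nat list \<Rightarrow> nat list \<Rightarrow> bool" where
  "is_product C1 C2 C \<longleftrightarrow>
     (\<exists>u v. diagram_iso C1 u \<and> diagram_iso C2 v \<and> set u \<inter> set v = {} \<and> diagram_iso (u @ v) C)"

text \<open>
  The graph $G(C)$: the vertices are the letters of \<open>C\<close>, and for each position \<open>i\<close> (a chord end)
  there is an arc from position \<open>i\<close> to the cyclically next position. The half-edges at position
  \<open>i\<close> are the final half \<open>Entering i\<close> of the arc that ends there and the initial half \<open>Leaving i\<close>
  of the arc that starts there. Along the distinguished Euler circuit, \<open>Entering i\<close> is immediately
  followed by \<open>Leaving i\<close>.
\<close>

datatype half_edge = Entering nat | Leaving nat

definition positions :: "nat list \<Rightarrow> nat \<Rightarrow> nat set" where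
  "positions C v = {i. i < length C \<and> C ! i = v}"

definition half_edges_at :: "nat list \<Rightarrow> nat \<Rightarrow> half_edge set" where
  "half_edges_at C v = Entering ` positions C v \<union> Leaving ` positions C v"

definition transitions :: "nat list \<Rightarrow> nat \<Rightarrow> half_edge set set set" where
  "transitions C v = {T. partition_on (half_edges_at C v) T \<and> (\<forall>p \<in> T. card p = 2)}"

definition type_phi :: "half_edge set set \<Rightarrow> bool" where
  "type_phi T \<longleftrightarrow> (\<exists>i. {Entering i, Leaving i} \<in> T)"

definition type_chi :: "half_edge set set \<Rightarrow> bool" where
  "type_chi T \<longleftrightarrow> (\<exists>i j. i \<noteq> j \<and> {Entering i, Leaving j} \<in> T)"

definition type_psi :: "half_edge set set \<Rightarrow> bool" where
  "type_psi T \<longleftrightarrow> (\<exists>i j. i \<noteq> j \<and> {Entering i, Entering j} \<in> T)"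

definition circuit_partitions :: "nat list \<Rightarrow> (nat \<Rightarrow> half_edge set set) set" where
  "circuit_partitions C = (\<Pi>\<^sub>E v \<in> set C. transitions C v)"

definition half_edges :: "nat list \<Rightarrow> half_edge set" where
  "half_edges C = (\<Union>v \<in> set C. half_edges_at C v)"

definition joined :: "nat list \<Rightarrow> (nat \<Rightarrow> half_edge set set) \<Rightarrow> half_edge rel" where
  "joined C P =
     {(Leaving i, Entering (Suc i mod length C)) | i. i < length C} \<union>
     {(h, h'). \<exists>v \<in> set C. {h, h'} \<in> P v}"

text \<open>
  The circles are the connected components of the half-edges under being halves of the same arc or
  being paired by a transition. The empty diagram has no half-edges, but its graph is one circle
  without vertices.
\<close>

definition num_circles :: "nat list \<Rightarrow> (nat \<Rightarrow> half_edge set set) \<Rightarrow> nat" where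
  "num_circles C P =
     (if C = [] then 1 else card (half_edges C // (joined C P \<union> (joined C P)\<inverse>)\<^sup>*))"

text \<open>The ring $\mathbb C[s,t,x]$ is represented as $\mathbb C[s][t][x]$.\<close>

type_synonym poly_stx = "complex poly poly poly"

definition var_s :: poly_stx where "var_s = [:[:[:0, 1:]:]:]"
definition var_t :: poly_stx where "var_t = [:[:0, 1:]:]"
definition var_x :: poly_stx where "var_x = [:0, 1:]"

text \<open>
  The three types are exhaustive and mutually exclusive for the transitions at a vertex of a chord
  diagram, so the default value is never used there.
\<close>

definition transition_weight :: "half_edge set set \<Rightarrow> poly_stx" where
  "transition_weight T =
     (if type_phi T then var_s else if type_psi T then var_t
      else if type_chi T then - var_t else 0)"

definition Q :: "nat list \<Rightarrow> poly_stx" where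
  "Q C = (\<Sum>P \<in> circuit_partitions C.
            (\<Prod>v \<in> set C. transition_weight (P v)) * var_x ^ (num_circles C P - 1))"

end

theory Submission
  imports Defs
begin

text \<open>
  A circuit partition is a state assigning a type $\phi$, $\chi$ or $\psi$ to every chord, and its
  circles are the components of a graph on the half-edges.

  Four-term relation: fix a state and smooth the chord $b$. If $a$ or $b$ is of type $\phi$, its ends
  do not interact with their neighbours, so $C$ agrees with $C'_{ab}$ and $\widetilde C_{ab}$ with
  $\widetilde C'_{ab}$. If $b$ is of type $\chi$, sliding the end $A$ along the strand through $b$
  identifies $C$ with $\widetilde C_{ab}$ and $C'_{ab}$ with $\widetilde C'_{ab}$. If $b$ is of type
  $\psi$, the slide reverses the direction of the strand at $A$, so $C$ corresponds to
  $\widetilde C'_{ab}$ and $C'_{ab}$ to $\widetilde C_{ab}$ with the types $\chi$ and $\psi$ of $a$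
  interchanged. This changes the sign of the weight, and the terms cancel in pairs.

  Multiplicativity: by parity, the two ends of a circle cut open lie on the same arc of any state;
  hence gluing two cut diagrams merges exactly two circles into one.
\<close>

section \<open>Connected components\<close>

text \<open>Circles are never traced: they are counted as components of an undirected graph, and two
  counts are compared by maps of half-edges that respect connectedness. Of the weights, the
  four-term relation uses only that \<chi> and \<psi> have opposite ones; multiplicativity holds for
  any weights, and there the exponent \<open>c(P) - 1\<close> turns the loss of one circle into
  addition of exponents. The change of type in the case where b is \<psi> comes from exchanging the
  entering and the leaving half-edge at the single end A while the other end of a stays as it is. In
  that case the four terms of one state need not cancel among themselves; they cancel against the
  four terms of the state with the type of a changed. The obstacle on words is that moving an end
  shifts positions and that u or v may be empty; hence ends carry fixed labels, and both strands are
  padded so that they are never empty.\<close>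

definition conn :: "'a rel \<Rightarrow> 'a rel" where
  "conn E = (E \<union> E\<inverse>)\<^sup>*"

definition comps :: "'a set \<Rightarrow> 'a rel \<Rightarrow> nat" where
  "comps V E = card (V // conn E)"

lemma conn_refl [simp, intro]: "(x, x) \<in> conn E"
  by (simp add: conn_def)

lemma conn_base: "(x, y) \<in> E \<Longrightarrow> (x, y) \<in> conn E"
  by (auto simp: conn_def)

lemma conn_sym: "(x, y) \<in> conn E \<Longrightarrow> (y, x) \<in> conn E"
  unfolding conn_def by (metis symD sym_Un_converse sym_rtrancl)

lemma conn_trans: "(x, y) \<in> conn E \<Longrightarrow> (y, z) \<in> conn E \<Longrightarrow> (x, z) \<in> conn E"
  unfolding conn_def by (rule rtrancl_trans)

lemma conn_base': "(y, x) \<in> E \<Longrightarrow> (x, y) \<in> conn E"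
  by (rule conn_sym, rule conn_base)

lemma equiv_conn: "equiv UNIV (conn E)"
proof (rule equivI)
  show "sym (conn E)" by (rule symI) (rule conn_sym)
  show "trans (conn E)" by (rule transI) (rule conn_trans)
qed (auto intro: refl_onI)

lemma conn_class_eq_iff: "conn E `` {x} = conn E `` {y} \<longleftrightarrow> (x, y) \<in> conn E"
  by (rule eq_equiv_class_iff[OF equiv_conn UNIV_I UNIV_I])

lemma conn_map:
  assumes "(x, y) \<in> conn E"
    and "\<And>x y. (x, y) \<in> E \<Longrightarrow> (f x, f y) \<in> conn E'"
  shows "(f x, f y) \<in> conn E'"
  using assms(1) unfolding conn_def[of E]
proof (induction rule: rtrancl_induct)
  case (step y z)
  then show ?case
    using assms(2) by (metis Un_iff conn_sym conn_trans converseD)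
qed auto

lemma conn_mono: "(x, y) \<in> conn E \<Longrightarrow> E \<subseteq> conn E' \<Longrightarrow> (x, y) \<in> conn E'"
  using conn_map[of x y E "\<lambda>x. x" E'] by auto

text \<open>The tool for proving that points are not connected, or for bounding a class: exhibit a
  set that no edge enters or leaves.\<close>

lemma conn_closed:
  assumes "(x, y) \<in> conn E" "x \<in> S" "\<And>a b. (a, b) \<in> E \<Longrightarrow> a \<in> S \<longleftrightarrow> b \<in> S"
  shows "y \<in> S"
  using assms(1) unfolding conn_def[of E]
  by (induction rule: rtrancl_induct) (use assms in auto)

lemma conn_sym_cong: "E \<union> E\<inverse> = E' \<union> E'\<inverse> \<Longrightarrow> conn E = conn E'"
  by (simp add: conn_def)

lemma conn_superset: "E \<subseteq> E' \<Longrightarrow> conn E \<subseteq> conn E'"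
  unfolding conn_def by (intro rtrancl_mono) auto

lemma conn_insert_redundant:
  assumes "(x, y) \<in> conn E"
  shows "conn (insert (x, y) E) = conn E"
proof
  have "insert (x, y) E \<subseteq> conn E"
    using assms conn_base by auto
  then show "conn (insert (x, y) E) \<subseteq> conn E"
    using conn_mono[of _ _ "insert (x, y) E" E] by auto
qed (rule conn_superset, auto)

lemma quotient_conn: "V // conn E = (\<lambda>x. conn E `` {x}) ` V"
  by (auto simp: quotient_def)

lemma card_image_same_kernel:
  assumes "\<And>x y. x \<in> V \<Longrightarrow> y \<in> V \<Longrightarrow> g x = g y \<longleftrightarrow> h x = h y"
  shows "card (g ` V) = card (h ` V)"
proof (rule bij_betw_same_card)
  show "bij_betw (\<lambda>w. h (inv_into V g w)) (g ` V) (h ` V)"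
  proof (rule bij_betw_imageI)
    show "inj_on (\<lambda>w. h (inv_into V g w)) (g ` V)"
      using assms by (auto simp: inj_on_def) (metis f_inv_into_f image_eqI inv_into_into)
    have "h (inv_into V g (g x)) = h x" if "x \<in> V" for x
      using that assms by (metis f_inv_into_f image_eqI inv_into_into)
    then show "(\<lambda>w. h (inv_into V g w)) ` g ` V = h ` V"
      by (simp add: image_image)
  qed
qed

text \<open>The maps need to be mutually inverse only up to connectedness, not on points. So one of
  them may collapse vertices, which is what contraction requires.\<close>

lemma comps_eqI:
  assumes f: "\<And>x y. (x, y) \<in> E \<Longrightarrow> (f x, f y) \<in> conn E'"
    and g: "\<And>x y. (x, y) \<in> E' \<Longrightarrow> (g x, g y) \<in> conn E"
    and V: "\<And>x. x \<in> V \<Longrightarrow> f x \<in> V' \<and> (g (f x), x) \<in> conn E"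
    and V': "\<And>y. y \<in> V' \<Longrightarrow> g y \<in> V \<and> (f (g y), y) \<in> conn E'"
  shows "comps V E = comps V' E'"
proof -
  have *: "(x, y) \<in> conn E \<longleftrightarrow> (f x, f y) \<in> conn E'" if "x \<in> V" "y \<in> V" for x y
  proof
    assume "(f x, f y) \<in> conn E'"
    then have "(g (f x), g (f y)) \<in> conn E"
      by (rule conn_map) (rule g)
    then show "(x, y) \<in> conn E"
      using V that by (meson conn_sym conn_trans)
  qed (rule conn_map, use f in auto)
  have "card ((\<lambda>x. conn E `` {x}) ` V) = card ((\<lambda>x. conn E' `` {f x}) ` V)"
    by (rule card_image_same_kernel) (use * in \<open>auto simp: conn_class_eq_iff\<close>)
  also have "(\<lambda>x. conn E' `` {f x}) ` V = (\<lambda>y. conn E' `` {y}) ` V'"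
  proof (intro equalityI subsetI)
    fix S assume "S \<in> (\<lambda>y. conn E' `` {y}) ` V'"
    then obtain y where y: "y \<in> V'" "S = conn E' `` {y}" by auto
    with V'[of y] have "S = conn E' `` {f (g y)}"
      by (simp add: conn_class_eq_iff conn_sym)
    with V'[of y] y show "S \<in> (\<lambda>x. conn E' `` {f x}) ` V" by auto
  qed (use V in auto)
  finally show ?thesis by (simp add: comps_def quotient_conn)
qed

text \<open>Collapsing \<open>n\<close> and \<open>m\<close> onto \<open>x\<close> changes no class,
  since they lie on a path with no other edges attached. Here \<open>n\<close> and \<open>m\<close>
  will be two half-edges paired by a transition, and the new edge is the strand with the vertex
  erased; \<open>x = y\<close> is allowed.\<close>

lemma comps_contract:
  assumes F: "Field F \<inter> {n, m} = {}" and xy: "{x, y} \<subseteq> V - {n, m}"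
  shows "comps V (F \<union> {(x, n), (n, m), (m, y)}) = comps (V - {n, m}) (F \<union> {(x, y)})"
    (is "comps V ?E = comps _ ?E'")
proof -
  have path: "(x, n) \<in> conn ?E" "(n, m) \<in> conn ?E" "(m, y) \<in> conn ?E"
    by (auto intro: conn_base)
  define f where "f = (\<lambda>h. if h = n \<or> h = m then x else h)"
  show ?thesis
  proof (rule comps_eqI[where f = f and g = "\<lambda>h. h"])
    fix a b assume "(a, b) \<in> ?E"
    then show "(f a, f b) \<in> conn ?E'"
      using F xy by (auto simp: f_def Field_def intro: conn_base)
  next
    fix a b assume "(a, b) \<in> ?E'"
    then show "(a, b) \<in> conn ?E"
      using path by (auto intro: conn_trans conn_base)
  next
    fix a assume "a \<in> V"
    then show "f a \<in> V - {n, m} \<and> (f a, a) \<in> conn ?E"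
      using xy path by (auto simp: f_def intro: conn_trans)
  qed (auto simp: f_def)
qed

lemma comps_sym_cong:
  assumes "E \<subseteq> E' \<union> E'\<inverse>" "E' \<subseteq> E \<union> E\<inverse>"
  shows "comps V E = comps V E'"
proof -
  have "conn E = conn E'"
    by (rule conn_sym_cong) (use assms in blast)
  then show ?thesis by (simp add: comps_def)
qed

text \<open>\<open>G\<close> and \<open>G'\<close> list the edges in the direction in which the
  strand is traversed; the inclusions absorb reordering and reversal, so that concrete edge sets can
  be supplied as they stand.\<close>

lemma comps_contract_cong:
  assumes "E \<subseteq> G \<union> G\<inverse>" "G \<subseteq> E \<union> E\<inverse>" "G = F \<union> {(x, n), (n, m), (m, y)}"
    and "Field F \<inter> {n, m} = {}" "{x, y} \<subseteq> V - {n, m}" "W = V - {n, m}"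
    and "E' \<subseteq> G' \<union> G'\<inverse>" "G' \<subseteq> E' \<union> E'\<inverse>" "G' = F \<union> {(x, y)}"
  shows "comps V E = comps W E'"
  using comps_contract[OF assms(4,5)] comps_sym_cong[OF assms(1,2)] comps_sym_cong[OF assms(7,8)]
    assms(3,6,9) by simp

text \<open>Smoothing one chord means contracting two paths at once, since its transition consists
  of two pairs. The paths are disjoint and all outer endpoints lie off them, so one contraction does
  not disturb the other.\<close>

lemma comps_contract2_cong:
  assumes E: "E \<subseteq> G \<union> G\<inverse>" "G \<subseteq> E \<union> E\<inverse>"
    and G: "G = F \<union> {(x, n), (n, m), (m, y), (x', n'), (n', m'), (m', y')}"
    and F: "Field F \<inter> {n, m, n', m'} = {}"
    and d: "{n, m} \<inter> {n', m'} = {}"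
    and xy: "{x, y, x', y'} \<subseteq> V - {n, m, n', m'}" and W: "W = V - {n, m, n', m'}"
    and E': "E' \<subseteq> G' \<union> G'\<inverse>" "G' \<subseteq> E' \<union> E'\<inverse>" "G' = F \<union> {(x, y), (x', y')}"
  shows "comps V E = comps W E'"
proof -
  let ?F = "F \<union> {(x', n'), (n', m'), (m', y')}"
  have "comps V E = comps V G"
    by (rule comps_sym_cong) (fact E)+
  also have "G = ?F \<union> {(x, n), (n, m), (m, y)}" unfolding G by blast
  also have "comps V \<dots> = comps (V - {n, m}) (?F \<union> {(x, y)})"
    by (rule comps_contract) (use F d xy in \<open>auto simp: Field_def\<close>)
  also have "?F \<union> {(x, y)} = (F \<union> {(x, y)}) \<union> {(x', n'), (n', m'), (m', y')}" by blast
  also have "comps (V - {n, m}) \<dots> = comps (V - {n, m} - {n', m'}) (F \<union> {(x, y)} \<union> {(x', y')})"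
    by (rule comps_contract) (use F d xy in \<open>auto simp: Field_def\<close>)
  also have "V - {n, m} - {n', m'} = W" unfolding W by blast
  also have "F \<union> {(x, y)} \<union> {(x', y')} = G'" unfolding E'(3) by blast
  also have "comps W G' = comps W E'"
    by (rule comps_sym_cong) (fact E')+
  finally show ?thesis .
qed

section \<open>Components of disjoint unions and the effect of a new edge\<close>

lemma comps_Un:
  assumes "finite V1" "finite V2" "V1 \<inter> V2 = {}" "E1 \<subseteq> V1 \<times> V1" "E2 \<subseteq> V2 \<times> V2"
  shows "comps (V1 \<union> V2) (E1 \<union> E2) = comps V1 E1 + comps V2 E2"
proof -
  have 1: "conn (E1 \<union> E2) `` {x} = conn E1 `` {x} \<and> conn E1 `` {x} \<subseteq> V1"
    if "x \<in> V1" "V1 \<inter> V2 = {}" "E1 \<subseteq> V1 \<times> V1" "E2 \<subseteq> V2 \<times> V2" for E1 E2 :: "'a rel" and x V1 V2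
  proof (intro conjI equalityI subsetI)
    fix y assume "y \<in> conn (E1 \<union> E2) `` {x}"
    then have "(x, y) \<in> conn (E1 \<union> E2)" by simp
    then have "y \<in> V1 \<inter> conn E1 `` {x}"
      by (rule conn_closed)
        (use that in \<open>auto intro: conn_trans conn_base conn_base'\<close>)
    then show "y \<in> conn E1 `` {x}" by simp
  next
    fix y assume "y \<in> conn E1 `` {x}"
    then show "y \<in> conn (E1 \<union> E2) `` {x}"
      using conn_superset[of E1 "E1 \<union> E2"] by auto
  next
    fix y assume "y \<in> conn E1 `` {x}"
    then have "(x, y) \<in> conn E1" by simp
    then show "y \<in> V1"
      by (rule conn_closed) (use that in auto)
  qed
  have a: "V1 // conn (E1 \<union> E2) = V1 // conn E1"
    using 1[of _ V1 V2 E1 E2] assms by (auto simp: quotient_conn)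
  have b: "V2 // conn (E1 \<union> E2) = V2 // conn E2"
    using 1[of _ V2 V1 E2 E1] assms by (auto simp: quotient_conn Un_commute Int_commute)
  have c: "V1 // conn E1 \<inter> V2 // conn E2 = {}"
  proof (rule ccontr)
    assume "V1 // conn E1 \<inter> V2 // conn E2 \<noteq> {}"
    then obtain x y where xy: "x \<in> V1" "y \<in> V2" "conn E1 `` {x} = conn E2 `` {y}"
      by (auto simp: quotient_conn)
    have "x \<in> conn E1 `` {x}" by simp
    then have "x \<in> V2"
      using 1[of y V2 V1 E2 E1] xy assms by (auto simp: Int_commute)
    with xy assms show False by auto
  qed
  have "(V1 \<union> V2) // conn (E1 \<union> E2) = V1 // conn E1 \<union> V2 // conn E2"
    using a b by (auto simp: quotient_conn image_Un)
  then show ?thesis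
    using c assms by (simp add: comps_def card_Un_disjoint quotient_conn)
qed

lemma comps_insert_bridge:
  assumes "finite V" "x \<in> V" "y \<in> V" "(x, y) \<notin> conn E"
  shows "comps V E = Suc (comps V (insert (x, y) E))"
proof -
  let ?X = "conn E `` {x}" and ?Y = "conn E `` {y}" and ?E = "insert (x, y) E"
  have sub: "(a, b) \<in> conn ?E" if "(a, b) \<in> conn E" for a b
    using that conn_superset[of E ?E] by auto
  have xy: "(x, y) \<in> conn ?E" by (auto intro: conn_base)
  have merged: "conn ?E `` {z} = ?X \<union> ?Y" if z: "z \<in> ?X \<union> ?Y" for z
  proof (intro equalityI subsetI)
    fix w assume "w \<in> conn ?E `` {z}"
    then have "(z, w) \<in> conn ?E" by simp
    then show "w \<in> ?X \<union> ?Y"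
      by (rule conn_closed) (use z in \<open>auto intro: conn_trans conn_base conn_base'\<close>)
  next
    fix w assume "w \<in> ?X \<union> ?Y"
    then have "(x, w) \<in> conn ?E"
      using sub xy by (auto intro: conn_trans)
    moreover have "(x, z) \<in> conn ?E"
      using sub xy z by (auto intro: conn_trans)
    ultimately show "w \<in> conn ?E `` {z}"
      by (auto intro: conn_trans conn_sym)
  qed
  have other: "conn ?E `` {z} = conn E `` {z}" if z: "z \<notin> ?X \<union> ?Y" for z
  proof (intro equalityI subsetI)
    fix w assume "w \<in> conn ?E `` {z}"
    then have "(z, w) \<in> conn ?E" by simp
    then show "w \<in> conn E `` {z}"
      by (rule conn_closed)
        (use z in \<open>auto intro: conn_trans conn_base conn_base' dest: conn_sym\<close>)
  qed (use sub in auto)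
  \<comment> \<open>The classes untouched by the new edge. Before it there are two further classes,
    \<open>?X\<close> and \<open>?Y\<close>; after it only their union.\<close>
  let ?O = "(\<lambda>z. conn E `` {z}) ` (V - (?X \<union> ?Y))"
  have V: "V = insert x (insert y (V - (?X \<union> ?Y))) \<union> (V \<inter> (?X \<union> ?Y))"
    using assms by auto
  have cls: "conn E `` {z} = ?X \<or> conn E `` {z} = ?Y" if "z \<in> ?X \<union> ?Y" for z
    using that by (auto simp: conn_class_eq_iff dest: conn_sym)
  have "V // conn E = insert ?X (insert ?Y ?O)"
    unfolding quotient_conn using cls assms by blast
  moreover have "V // conn ?E = insert (?X \<union> ?Y) ?O"
  proof (intro equalityI subsetI)
    fix S assume "S \<in> V // conn ?E"
    then obtain z where "z \<in> V" "S = conn ?E `` {z}" by (auto simp: quotient_conn)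
    then show "S \<in> insert (?X \<union> ?Y) ?O"
      using merged[of z] other[of z] by (cases "z \<in> ?X \<union> ?Y") auto
  next
    fix S assume "S \<in> insert (?X \<union> ?Y) ?O"
    then show "S \<in> V // conn ?E"
      unfolding quotient_conn using merged[of x] other assms(2) by (fastforce simp: image_iff)
  qed
  moreover have "?X \<notin> ?O" "?Y \<notin> ?O" "?X \<union> ?Y \<notin> ?O" "?X \<noteq> ?Y"
    using assms(4) by (auto simp: conn_class_eq_iff dest: conn_sym)
  moreover have "finite ?O" using assms by simp
  ultimately show ?thesis by (simp add: comps_def)
qed

lemma comps_pos: "finite V \<Longrightarrow> V \<noteq> {} \<Longrightarrow> comps V E \<ge> 1"
  by (simp add: comps_def quotient_conn Suc_le_eq card_gt_0_iff)

section \<open>Arcs, pairings and states\<close>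

text \<open>The circle cut open, kept apart from its closing arc in \<open>arcs\<close>: cutting and
  gluing diagrams affects only closing arcs.\<close>

fun path :: "nat list \<Rightarrow> half_edge rel" where
  "path (x # y # zs) = insert (Leaving x, Entering y) (path (y # zs))"
| "path zs = {}"

definition arcs :: "nat list \<Rightarrow> half_edge rel" where
  "arcs L = (if L = [] then {} else insert (Leaving (last L), Entering (hd L)) (path L))"

definition halves :: "nat set \<Rightarrow> half_edge set" where
  "halves X = Entering ` X \<union> Leaving ` X"

lemma halves_simps [simp]:
  "Entering x \<in> halves X \<longleftrightarrow> x \<in> X" "Leaving x \<in> halves X \<longleftrightarrow> x \<in> X"
  by (auto simp: halves_def)

lemma halves_Un: "halves (X \<union> Y) = halves X \<union> halves Y"
  by (auto simp: halves_def)

lemma finite_halves [simp]: "finite X \<Longrightarrow> finite (halves X)"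
  by (simp add: halves_def)

primrec map_half :: "(nat \<Rightarrow> nat) \<Rightarrow> half_edge \<Rightarrow> half_edge" where
  "map_half f (Entering i) = Entering (f i)"
| "map_half f (Leaving i) = Leaving (f i)"

lemma path_append:
  "xs \<noteq> [] \<Longrightarrow> ys \<noteq> [] \<Longrightarrow>
    path (xs @ ys) = path xs \<union> path ys \<union> {(Leaving (last xs), Entering (hd ys))}"
proof (induction xs rule: path.induct)
  case ("2_2" x)
  then show ?case by (cases ys) auto
qed auto

lemma path_subset: "path xs \<subseteq> Leaving ` set xs \<times> Entering ` set xs"
  by (induction xs rule: path.induct) auto

lemma path_map: "path (map f xs) = map_prod (map_half f) (map_half f) ` path xs"
  by (induction xs rule: path.induct) auto

lemma arcs_map: "arcs (map f xs) = map_prod (map_half f) (map_half f) ` arcs xs"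
  by (auto simp: arcs_def path_map hd_map last_map)

lemma arcs_rotate: "arcs (xs @ ys) = arcs (ys @ xs)"
  by (cases "xs = []"; cases "ys = []") (auto simp: arcs_def path_append)

lemma arcs_subset: "arcs xs \<subseteq> Leaving ` set xs \<times> Entering ` set xs"
  using path_subset[of xs] by (auto simp: arcs_def)

lemma path_upt: "path [0..<n] = {(Leaving i, Entering (Suc i)) | i. Suc i < n}"
proof (induction n)
  case (Suc n)
  show ?case
  proof (cases "n = 0")
    case False
    have "path [0..<Suc n] = path ([0..<n] @ [n])" by simp
    also have "\<dots> = insert (Leaving (n - 1), Entering n) (path [0..<n])"
      using False by (subst path_append) (auto simp: last_upt)
    also have "\<dots> = {(Leaving i, Entering (Suc i)) | i. Suc i < Suc n}"
      using False Suc by (auto simp: less_Suc_eq)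
    finally show ?thesis .
  qed auto
qed auto

lemma arcs_upt: "arcs [0..<n] = {(Leaving i, Entering (Suc i mod n)) | i. i < n}"
proof (cases n)
  case (Suc m)
  have n: "[0..<n] \<noteq> []" "last [0..<n] = m" "hd [0..<n] = 0"
    using Suc by (simp_all add: upt_rec[of 0])
  have "Suc i mod n = (if i = m then 0 else Suc i)" if "i < n" for i
    using that Suc by auto
  then show ?thesis
    unfolding arcs_def path_upt using n Suc by (auto simp del: upt_Suc split: if_splits)
qed (auto simp: arcs_def)

section \<open>Types, states and the state sum\<close>

datatype ttype = Phi | Chi | Psi

lemma UNIV_ttype: "UNIV = {Phi, Chi, Psi}"
  using ttype.exhaust by auto

fun weight :: "ttype \<Rightarrow> poly_stx" where
  "weight Phi = var_s" | "weight Psi = var_t" | "weight Chi = - var_t"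

text \<open>All transitions of a state at once, as edges. It depends on the set of ends and not on
  their cyclic order. Entering-leaving pairs are recorded in one direction only, because
  connectedness symmetrises anyway.\<close>

definition pairing :: "nat set \<Rightarrow> (nat \<Rightarrow> nat) \<Rightarrow> (nat \<Rightarrow> ttype) \<Rightarrow> half_edge rel" where
  "pairing X c \<sigma> =
     {(Entering i, Leaving i) | i. i \<in> X \<and> \<sigma> (c i) = Phi} \<union>
     {(Entering i, Leaving j) | i j. i \<in> X \<and> j \<in> X \<and> i \<noteq> j \<and> c i = c j \<and> \<sigma> (c i) = Chi} \<union>
     {(Entering i, Entering j) | i j. i \<in> X \<and> j \<in> X \<and> i \<noteq> j \<and> c i = c j \<and> \<sigma> (c i) = Psi} \<union>
     {(Leaving i, Leaving j) | i j. i \<in> X \<and> j \<in> X \<and> i \<noteq> j \<and> c i = c j \<and> \<sigma> (c i) = Psi}"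

lemma pairing_iff [simp]:
  "(Entering i, Leaving j) \<in> pairing X c \<sigma> \<longleftrightarrow> i \<in> X \<and> j \<in> X \<and> c i = c j \<and>
     \<sigma> (c i) = (if i = j then Phi else Chi)"
  "(Entering i, Entering j) \<in> pairing X c \<sigma> \<longleftrightarrow> i \<in> X \<and> j \<in> X \<and> i \<noteq> j \<and> c i = c j \<and> \<sigma> (c i) = Psi"
  "(Leaving i, Leaving j) \<in> pairing X c \<sigma> \<longleftrightarrow> i \<in> X \<and> j \<in> X \<and> i \<noteq> j \<and> c i = c j \<and> \<sigma> (c i) = Psi"
  "(Leaving i, Entering j) \<notin> pairing X c \<sigma>"
  by (auto simp: pairing_def)

lemma pairing_subset: "pairing X c \<sigma> \<subseteq> halves X \<times> halves X"
  by (auto simp: pairing_def halves_def)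

lemma pairing_Un:
  assumes "c ` X \<inter> c ` Y = {}"
  shows "pairing (X \<union> Y) c \<sigma> = pairing X c \<sigma> \<union> pairing Y c \<sigma>"
proof -
  have "c i \<noteq> c j" "c j \<noteq> c i" if "i \<in> X" "j \<in> Y" for i j
    using assms that by (auto simp: disjoint_iff image_iff)
  then show ?thesis
    by (auto simp: pairing_def)
qed

lemma pairing_cong:
  assumes "\<And>i. i \<in> X \<Longrightarrow> \<sigma> (c i) = \<sigma>' (c' i)"
    and "\<And>i j. i \<in> X \<Longrightarrow> j \<in> X \<Longrightarrow> c i = c j \<longleftrightarrow> c' i = c' j"
  shows "pairing X c \<sigma> = pairing X c' \<sigma>'"
  using assms by (auto simp: pairing_def)

lemma pairing_image:
  assumes "inj_on f X"
  shows "pairing (f ` X) c \<sigma> =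
    map_prod (map_half f) (map_half f) ` pairing X (c \<circ> f) \<sigma>"
proof -
  have eq: "f i = f j \<longleftrightarrow> i = j" if "i \<in> X" "j \<in> X" for i j
    using assms that by (auto dest: inj_onD)
  let ?g = "map_prod (map_half f) (map_half f)"
  have im: "(map_half f a, map_half f b) \<in> ?g ` R" if "(a, b) \<in> R" for a b R
    using imageI[OF that, of ?g] by simp
  show ?thesis
  proof (intro equalityI subrelI)
    fix a b assume "(a, b) \<in> pairing (f ` X) c \<sigma>"
    then show "(a, b) \<in> ?g ` pairing X (c \<circ> f) \<sigma>"
      using im[of "Entering _" "Leaving _"] im[of "Entering _" "Entering _"]
        im[of "Leaving _" "Leaving _"]
      by (cases a; cases b) (auto simp: eq split: if_splits)
  next
    fix a b assume "(a, b) \<in> ?g ` pairing X (c \<circ> f) \<sigma>"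
    then obtain a' b' where "(a', b') \<in> pairing X (c \<circ> f) \<sigma>" "a = map_half f a'" "b = map_half f b'"
      by auto
    then show "(a, b) \<in> pairing (f ` X) c \<sigma>"
      by (cases a'; cases b') (auto simp: eq split: if_splits)
  qed
qed

text \<open>The edges \<open>M\<close> are a parameter rather than a pairing, so that points which
  are ends of no chord can be added with edges of their own. The value at the empty list is the
  circle without vertices.\<close>

definition circles :: "nat list \<Rightarrow> half_edge rel \<Rightarrow> nat" where
  "circles L M = (if L = [] then 1 else comps (halves (set L)) (arcs L \<union> M))"

lemma circles_pos: "circles L M \<ge> 1"
  using comps_pos[of "halves (set L)"] by (auto simp: circles_def halves_def)

lemma circles_rotate: "circles (xs @ ys) M = circles (ys @ xs) M"
  by (simp add: circles_def arcs_rotate[of xs ys] Un_commute)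

lemma comps_image:
  assumes "inj_on f V" "E \<subseteq> V \<times> V"
  shows "comps (f ` V) (map_prod f f ` E) = comps V E"
proof (rule comps_eqI[where f = "inv_into V f" and g = f])
  fix x y assume "(x, y) \<in> map_prod f f ` E"
  then show "(inv_into V f x, inv_into V f y) \<in> conn E"
    using assms by (auto intro!: conn_base simp: subset_iff)
next
  fix x y assume "(x, y) \<in> E"
  then show "(f x, f y) \<in> conn (map_prod f f ` E)"
    by (auto intro: conn_base)
qed (use assms in \<open>auto simp: inv_into_into\<close>)

lemma circles_map:
  assumes "inj_on f (set L)"
  shows "circles (map f L) (pairing (f ` set L) c \<sigma>) = circles L (pairing (set L) (c \<circ> f) \<sigma>)"
proof (cases "L = []")
  case False
  have "inj_on (map_half f) (halves (set L))"
  proof (rule inj_onI)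
    fix a b assume "a \<in> halves (set L)" "b \<in> halves (set L)" "map_half f a = map_half f b"
    then show "a = b"
      using inj_onD[OF assms] by (cases a; cases b) auto
  qed
  moreover have "arcs L \<union> pairing (set L) (c \<circ> f) \<sigma> \<subseteq> halves (set L) \<times> halves (set L)"
    using arcs_subset[of L] pairing_subset[of "set L" "c \<circ> f" \<sigma>]
    unfolding halves_def by blast
  moreover have "halves (f ` set L) = map_half f ` halves (set L)"
    by (auto simp: halves_def image_image image_Un)
  ultimately show ?thesis
    using False by (simp add: circles_def arcs_map pairing_image[OF assms] comps_image
        image_Un[symmetric])
qed (simp add: circles_def)

definition state_weight :: "nat set \<Rightarrow> (nat \<Rightarrow> ttype) \<Rightarrow> poly_stx" where
  "state_weight S \<sigma> = (\<Prod>v\<in>S. weight (\<sigma> v))"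

text \<open>The circle is a list \<open>L\<close> of distinct chord ends, and \<open>c\<close> maps an end to its chord; diagrams in a
  four-term relation then have the same ends, half-edges and pairings, and differ only in \<open>L\<close>.\<close>

definition Z :: "nat list \<Rightarrow> (nat \<Rightarrow> nat) \<Rightarrow> poly_stx" where
  "Z L c = (\<Sum>\<sigma> \<in> c ` set L \<rightarrow>\<^sub>E UNIV.
     state_weight (c ` set L) \<sigma> * var_x ^ (circles L (pairing (set L) c \<sigma>) - 1))"

lemma Z_rotate: "Z (xs @ ys) c = Z (ys @ xs) c"
  by (simp add: Z_def circles_rotate[of xs ys] Un_commute)

lemma Z_map: "inj_on f (set L) \<Longrightarrow> Z (map f L) c = Z L (c \<circ> f)"
  by (simp add: Z_def circles_map image_comp comp_def[symmetric])

lemma Z_rename: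
  assumes g: "inj_on g (c ` set L)"
  shows "Z L (g \<circ> c) = Z L c"
proof -
  let ?S = "c ` set L"
  let ?h = "inv_into ?S g"
  have h: "?h (g v) = v" if "v \<in> ?S" for v using g that by simp
  have "Z L c = (\<Sum>\<sigma> \<in> g ` ?S \<rightarrow>\<^sub>E UNIV.
     state_weight (g ` ?S) \<sigma> * var_x ^ (circles L (pairing (set L) (g \<circ> c) \<sigma>) - 1))"
    unfolding Z_def
  proof (rule sum.reindex_bij_witness[where
        i = "\<lambda>\<sigma>. restrict (\<sigma> \<circ> g) ?S" and j = "\<lambda>\<sigma>. restrict (\<sigma> \<circ> ?h) (g ` ?S)"])
    fix \<sigma> assume "\<sigma> \<in> ?S \<rightarrow>\<^sub>E (UNIV :: ttype set)"
    then show "restrict (restrict (\<sigma> \<circ> ?h) (g ` ?S) \<circ> g) ?S = \<sigma>"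
      using h by (auto simp: PiE_def extensional_def fun_eq_iff restrict_def)
    have "state_weight (g ` ?S) (restrict (\<sigma> \<circ> ?h) (g ` ?S)) = state_weight ?S \<sigma>"
      unfolding state_weight_def using g h by (simp add: prod.reindex)
    moreover have "pairing (set L) (g \<circ> c) (restrict (\<sigma> \<circ> ?h) (g ` ?S)) = pairing (set L) c \<sigma>"
      by (rule pairing_cong) (use g h in \<open>auto simp: inj_on_eq_iff\<close>)
    ultimately show "state_weight (g ` ?S) (restrict (\<sigma> \<circ> ?h) (g ` ?S)) *
        var_x ^ (circles L (pairing (set L) (g \<circ> c) (restrict (\<sigma> \<circ> ?h) (g ` ?S))) - 1) =
        state_weight ?S \<sigma> * var_x ^ (circles L (pairing (set L) c \<sigma>) - 1)"
      by simp
  next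
    fix \<sigma> assume "\<sigma> \<in> g ` ?S \<rightarrow>\<^sub>E (UNIV :: ttype set)"
    then show "restrict (restrict (\<sigma> \<circ> g) ?S \<circ> ?h) (g ` ?S) = \<sigma>"
      using h by (auto simp: PiE_def extensional_def fun_eq_iff restrict_def)
  qed auto
  then show ?thesis by (simp add: Z_def image_comp)
qed

section \<open>Splittings of four half-edges into two pairs\<close>

lemma distinct_pairs_unique:
  assumes T: "partition_on {a, b, c, d} T" "\<forall>p\<in>T. card p = 2"
    and d: "distinct [a, b, c, d]" and ab: "{a, b} \<in> T"
  shows "T = {{a, b}, {c, d}}"
proof -
  have other: "p = {c, d}" if p: "p \<in> T" "p \<noteq> {a, b}" for p
  proof (rule card_subset_eq)
    have "p \<inter> {a, b} = {}"
      using disjointD[OF partition_onD2[OF T(1)] p(1) ab p(2)] .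
    moreover have "p \<subseteq> {a, b, c, d}"
      using partition_onD1[OF T(1)] p(1) by blast
    ultimately show "p \<subseteq> {c, d}" by blast
    show "card p = card {c, d}" using T(2) p(1) d by simp
  qed simp
  have "c \<in> \<Union>T" using partition_onD1[OF T(1)] by blast
  then obtain p where p: "p \<in> T" "c \<in> p" by blast
  then have "p \<noteq> {a, b}" using d by auto
  with p have "{c, d} \<in> T" using other by blast
  then show ?thesis using ab other by blast
qed

text \<open>The partner of \<open>a\<close> determines the splitting, because the remaining two
  points must form the other pair.\<close>

lemma pair_partitions:
  assumes d: "distinct [a, b, c, d]"
  shows "{T. partition_on {a, b, c, d} T \<and> (\<forall>p\<in>T. card p = 2)} =
    {{{a, b}, {c, d}}, {{a, c}, {b, d}}, {{a, d}, {b, c}}}"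
proof (intro equalityI subsetI)
  fix T assume "T \<in> {T. partition_on {a, b, c, d} T \<and> (\<forall>p\<in>T. card p = 2)}"
  then have T: "partition_on {a, b, c, d} T" "\<forall>p\<in>T. card p = 2" by auto
  have "a \<in> \<Union>T" using partition_onD1[OF T(1)] by blast
  then obtain p where p: "p \<in> T" "a \<in> p" by blast
  then obtain y where y: "p = {a, y}" "y \<noteq> a"
    using T(2) by (metis card_2_iff doubleton_eq_iff insertE singletonD)
  have "y \<in> {a, b, c, d}" using partition_onD1[OF T(1)] p(1) y(1) by blast
  then consider "y = b" | "y = c" | "y = d" using y(2) by auto
  then show "T \<in> {{{a, b}, {c, d}}, {{a, c}, {b, d}}, {{a, d}, {b, c}}}"
  proof cases
    case 1
    then have "T = {{a, b}, {c, d}}" using distinct_pairs_unique[OF T d] p y by blast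
    then show ?thesis by blast
  next
    case 2
    have "{a, b, c, d} = {a, c, b, d}" by auto
    then have "T = {{a, c}, {b, d}}"
      using distinct_pairs_unique[of a c b d T] T d p y 2 by auto
    then show ?thesis by blast
  next
    case 3
    have "{a, b, c, d} = {a, d, b, c}" by auto
    then have "T = {{a, d}, {b, c}}"
      using distinct_pairs_unique[of a d b c T] T d p y 3 by auto
    then show ?thesis by blast
  qed
next
  fix T assume "T \<in> {{{a, b}, {c, d}}, {{a, c}, {b, d}}, {{a, d}, {b, c}}}"
  then show "T \<in> {T. partition_on {a, b, c, d} T \<and> (\<forall>p\<in>T. card p = 2)}"
    using d by (auto simp: partition_on_def disjoint_def card_insert_if)
qed

section \<open>The polynomial as a sum over states\<close>

text \<open>Translates an abstract type into a transition. It is meant for the set \<open>X\<close>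
  of the two positions of a chord, where it is a bijection onto the three transitions.\<close>

fun trans_of :: "nat set \<Rightarrow> ttype \<Rightarrow> half_edge set set" where
  "trans_of X Phi = {{Entering i, Leaving i} | i. i \<in> X}"
| "trans_of X Chi = {{Entering i, Leaving j} | i j. i \<in> X \<and> j \<in> X \<and> i \<noteq> j}"
| "trans_of X Psi = {{Entering i, Entering j} | i j. i \<in> X \<and> j \<in> X \<and> i \<noteq> j} \<union>
     {{Leaving i, Leaving j} | i j. i \<in> X \<and> j \<in> X \<and> i \<noteq> j}"

lemma trans_of_iff:
  "{Entering i, Leaving j} \<in> trans_of X \<tau> \<longleftrightarrow> i \<in> X \<and> j \<in> X \<and> \<tau> = (if i = j then Phi else Chi)"
  "{Leaving j, Entering i} \<in> trans_of X \<tau> \<longleftrightarrow> i \<in> X \<and> j \<in> X \<and> \<tau> = (if i = j then Phi else Chi)"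
  "{Entering i, Entering j} \<in> trans_of X \<tau> \<longleftrightarrow> i \<in> X \<and> j \<in> X \<and> i \<noteq> j \<and> \<tau> = Psi"
  "{Leaving i, Leaving j} \<in> trans_of X \<tau> \<longleftrightarrow> i \<in> X \<and> j \<in> X \<and> i \<noteq> j \<and> \<tau> = Psi"
  by (cases \<tau>; auto simp: doubleton_eq_iff)+

lemma inj_trans_of:
  assumes "i \<noteq> j"
  shows "inj (trans_of {i, j})"
proof (rule injI)
  fix \<tau> \<tau>' assume eq: "trans_of {i, j} \<tau> = trans_of {i, j} \<tau>'"
  have "{Entering i, Leaving i} \<in> trans_of {i, j} \<tau> \<longleftrightarrow> {Entering i, Leaving i} \<in> trans_of {i, j} \<tau>'"
    "{Entering i, Leaving j} \<in> trans_of {i, j} \<tau> \<longleftrightarrow> {Entering i, Leaving j} \<in> trans_of {i, j} \<tau>'"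
    by (simp_all only: eq)
  then show "\<tau> = \<tau>'"
    using assms by (cases \<tau>; cases \<tau>') (simp_all add: trans_of_iff del: trans_of.simps)
qed

lemma transition_weight_trans_of:
  assumes "i \<noteq> j"
  shows "transition_weight (trans_of {i, j} \<tau>) = weight \<tau>"
proof -
  have "type_phi (trans_of {i, j} \<tau>) \<longleftrightarrow> \<tau> = Phi"
    "type_psi (trans_of {i, j} \<tau>) \<longleftrightarrow> \<tau> = Psi"
    "type_chi (trans_of {i, j} \<tau>) \<longleftrightarrow> \<tau> = Chi"
    using assms by (auto simp: type_phi_def type_psi_def type_chi_def trans_of_iff)
  then show ?thesis
    by (cases \<tau>) (simp_all add: transition_weight_def)
qed

lemma card_positions: "card (positions C v) = count_list C v"
  unfolding count_list_eq_length_filter length_filter_conv_card positions_def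
  by (rule arg_cong[of _ _ card]) auto

lemma positions_chord:
  assumes "chord_diagram C" "v \<in> set C"
  obtains i j where "i \<noteq> j" "positions C v = {i, j}"
  using assms card_positions[of C v] that by (auto simp: chord_diagram_def card_2_iff)

lemma transitions_eq:
  assumes "i \<noteq> j" "positions C v = {i, j}"
  shows "transitions C v = range (trans_of {i, j})"
proof -
  have "half_edges_at C v = {Entering i, Leaving i, Entering j, Leaving j}"
    using assms(2) by (auto simp: half_edges_at_def)
  then have "transitions C v = {{{Entering i, Leaving i}, {Entering j, Leaving j}},
      {{Entering i, Entering j}, {Leaving i, Leaving j}},
      {{Entering i, Leaving j}, {Leaving i, Entering j}}}"
    unfolding transitions_def using assms(1) by (simp only:) (rule pair_partitions, simp)
  moreover have "trans_of {i, j} Phi = {{Entering i, Leaving i}, {Entering j, Leaving j}}"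
    by auto
  moreover have "trans_of {i, j} Psi = {{Entering i, Entering j}, {Leaving i, Leaving j}}"
    using assms(1) by (auto simp: doubleton_eq_iff)
  moreover have "trans_of {i, j} Chi = {{Entering i, Leaving j}, {Leaving i, Entering j}}"
    using assms(1) by (auto simp: doubleton_eq_iff)
  ultimately show ?thesis
    by (auto simp: UNIV_ttype)
qed

text \<open>Membership of an unordered pair in a transition is symmetric, so \<open>joined\<close>
  contains each pairing edge in both directions and \<open>pairing\<close> need not; the symmetric
  closures agree. The empty word gives 1 on both sides.\<close>

lemma num_circles_eq:
  assumes "\<And>v. v \<in> set C \<Longrightarrow> P v = trans_of (positions C v) (\<sigma> v)"
  shows "num_circles C P = circles [0..<length C] (pairing {0..<length C} ((!) C) \<sigma>)"
proof -
  let ?M = "pairing {0..<length C} ((!) C) \<sigma>"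
  have "{(h, h'). \<exists>v\<in>set C. {h, h'} \<in> P v} = ?M \<union> ?M\<inverse>"
  proof (intro set_eqI)
    fix p :: "half_edge \<times> half_edge"
    obtain h h' where p: "p = (h, h')" by force
    show "p \<in> {(h, h'). \<exists>v\<in>set C. {h, h'} \<in> P v} \<longleftrightarrow> p \<in> ?M \<union> ?M\<inverse>"
      using assms unfolding p
      by (cases h; cases h') (auto simp: trans_of_iff positions_def)
  qed
  moreover have "{(Leaving i, Entering (Suc i mod length C)) | i. i < length C} = arcs [0..<length C]"
    by (simp add: arcs_upt)
  ultimately have joined: "joined C P = arcs [0..<length C] \<union> (?M \<union> ?M\<inverse>)"
    by (simp add: joined_def)
  have "conn (joined C P) = conn (arcs [0..<length C] \<union> ?M)"
    by (rule conn_sym_cong) (auto simp: joined)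
  moreover have "half_edges C = halves {0..<length C}"
    by (auto simp: half_edges_def half_edges_at_def halves_def positions_def
        intro!: bexI[where x = "C ! _"])
  ultimately show ?thesis
    by (simp add: num_circles_def circles_def comps_def conn_def[of "joined C P", symmetric])
qed

text \<open>Circuit partitions and states correspond vertex by vertex through
  \<open>trans_of\<close>, which is invertible because every letter has exactly two
  positions.\<close>

lemma Q_eq_Z_upt:
  assumes "chord_diagram C"
  shows "Q C = Z [0..<length C] ((!) C)"
proof -
  let ?T = "\<lambda>v. trans_of (positions C v)"
  have S: "(!) C ` set [0..<length C] = set C"
    using nth_image[of "length C" C] by (auto simp: in_set_conv_nth image_iff Bex_def)
  have inj: "inj (?T v)" and trans: "transitions C v = range (?T v)"
    and wt: "\<And>\<tau>. transition_weight (?T v \<tau>) = weight \<tau>" if v: "v \<in> set C" for v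
  proof -
    obtain i j where ij: "i \<noteq> j" "positions C v = {i, j}"
      using positions_chord[OF assms v] .
    show "inj (?T v)" "transitions C v = range (?T v)"
      using inj_trans_of transitions_eq ij by auto
    show "transition_weight (?T v \<tau>) = weight \<tau>" for \<tau>
      using transition_weight_trans_of ij by simp
  qed
  have "(\<Sum>\<sigma> \<in> set C \<rightarrow>\<^sub>E UNIV. state_weight (set C) \<sigma> *
      var_x ^ (circles [0..<length C] (pairing {0..<length C} ((!) C) \<sigma>) - 1)) =
    (\<Sum>P \<in> circuit_partitions C.
      (\<Prod>v \<in> set C. transition_weight (P v)) * var_x ^ (num_circles C P - 1))"
  proof (rule sum.reindex_bij_witness[where
        i = "\<lambda>P. \<lambda>v\<in>set C. inv (?T v) (P v)" and j = "\<lambda>\<sigma>. \<lambda>v\<in>set C. ?T v (\<sigma> v)"])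
    fix \<sigma> assume \<sigma>: "\<sigma> \<in> set C \<rightarrow>\<^sub>E (UNIV :: ttype set)"
    then show "(\<lambda>v\<in>set C. inv (?T v) ((\<lambda>v\<in>set C. ?T v (\<sigma> v)) v)) = \<sigma>"
      by (auto simp: fun_eq_iff inj inv_f_f PiE_def extensional_def)
    show "(\<lambda>v\<in>set C. ?T v (\<sigma> v)) \<in> circuit_partitions C"
      by (auto simp: circuit_partitions_def trans)
    have "num_circles C (\<lambda>v\<in>set C. ?T v (\<sigma> v)) =
        circles [0..<length C] (pairing {0..<length C} ((!) C) \<sigma>)"
      by (rule num_circles_eq) simp
    then show "(\<Prod>v \<in> set C. transition_weight ((\<lambda>v\<in>set C. ?T v (\<sigma> v)) v)) *
        var_x ^ (num_circles C (\<lambda>v\<in>set C. ?T v (\<sigma> v)) - 1) =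
      state_weight (set C) \<sigma> *
        var_x ^ (circles [0..<length C] (pairing {0..<length C} ((!) C) \<sigma>) - 1)"
      by (simp add: state_weight_def wt)
  next
    fix P assume P: "P \<in> circuit_partitions C"
    then have "P v \<in> range (?T v)" if "v \<in> set C" for v
      using that trans by (auto simp: circuit_partitions_def)
    then show "(\<lambda>v\<in>set C. ?T v ((\<lambda>v\<in>set C. inv (?T v) (P v)) v)) = P"
      using P by (auto simp: fun_eq_iff f_inv_into_f circuit_partitions_def PiE_def extensional_def)
    show "(\<lambda>v\<in>set C. inv (?T v) (P v)) \<in> set C \<rightarrow>\<^sub>E (UNIV :: ttype set)"
      by auto
  qed
  then show ?thesis
    unfolding Z_def S Q_def by simp
qed

text \<open>Positions are transported to arbitrary distinct labels along \<open>(!) L\<close>, so an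
  end keeps its name when it is moved to another place in the word.\<close>

lemma Q_eq_Z:
  assumes "chord_diagram (map c L)" "distinct L"
  shows "Q (map c L) = Z L c"
proof -
  have "Q (map c L) = Z [0..<length L] ((!) (map c L))"
    using Q_eq_Z_upt[OF assms(1)] by simp
  also have "\<dots> = Z [0..<length L] (c \<circ> (!) L)"
  proof -
    have "(!) (map c L) ` set [0..<length L] = (c \<circ> (!) L) ` set [0..<length L]"
      by (intro image_cong) auto
    moreover have "pairing (set [0..<length L]) ((!) (map c L)) \<sigma> =
        pairing (set [0..<length L]) (c \<circ> (!) L) \<sigma>" for \<sigma>
      by (rule pairing_cong) auto
    ultimately show ?thesis by (simp only: Z_def)
  qed
  also have "\<dots> = Z (map ((!) L) [0..<length L]) c"
    by (rule Z_map[symmetric]) (use assms(2) in \<open>auto simp: inj_on_def nth_eq_iff_index_eq\<close>)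
  also have "\<dots> = Z L c" by (simp add: map_nth)
  finally show ?thesis .
qed

section \<open>Independence of the cut point and of the names of the chords\<close>

lemma word_labelling: obtains L and c :: "nat \<Rightarrow> nat" where "distinct L" "map c L = C"
  using that[of "[0..<length C]" "(!) C"] by (simp add: map_nth)

lemma chord_diagram_iso:
  assumes "chord_diagram C" "diagram_iso C D"
  shows "chord_diagram D"
proof -
  obtain k f where f: "inj_on f (set C)" "D = map f (rotate k C)"
    using assms(2) by (auto simp: diagram_iso_def)
  have "count_list (map f (rotate k C)) (f a) = count_list C a" if a: "a \<in> set C" for a
  proof -
    have "count_list (map f (rotate k C)) (f a) = count_list (rotate k C) a"
      using inj_on_eq_iff[OF f(1)] a
      by (auto simp: count_list_eq_length_filter filter_map comp_def
          intro!: arg_cong[of _ _ length] filter_cong)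
    then show ?thesis
      by (metis count_list_append append_take_drop_id add.commute rotate_drop_take)
  qed
  then show ?thesis
    using assms(1) f(2) by (auto simp: chord_diagram_def)
qed

text \<open>With labelled ends the two ingredients of an isomorphism separate: rotation acts on
  \<open>L\<close> only, renaming on \<open>c\<close> only, and \<open>Z\<close> is invariant under
  each.\<close>

lemma Q_iso:
  assumes C: "chord_diagram C" and iso: "diagram_iso C D"
  shows "Q C = Q D"
proof -
  obtain k f where f: "inj_on f (set C)" "D = map f (rotate k C)"
    using iso by (auto simp: diagram_iso_def)
  obtain L and c :: "nat \<Rightarrow> nat" where L: "distinct L" "map c L = C"
    by (rule word_labelling)
  have D: "D = map (f \<circ> c) (rotate k L)"
    using f L(2)[symmetric] by (simp add: rotate_map)
  have "Q D = Z (rotate k L) (f \<circ> c)"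
    using Q_eq_Z[of "f \<circ> c" "rotate k L"] chord_diagram_iso[OF C iso] D L by simp
  also have "\<dots> = Z L (f \<circ> c)"
    by (metis Z_rotate append_take_drop_id rotate_drop_take)
  also have "\<dots> = Z L c"
    by (rule Z_rename) (use f L in auto)
  also have "\<dots> = Q C"
    using Q_eq_Z[of c L] C L by simp
  finally show ?thesis by simp
qed

section \<open>Multiplicativity\<close>

text \<open>The chord diagram condition for labelled ends. It ignores their order, so it holds at
  once for all four diagrams of a relation.\<close>

definition two_ended :: "(nat \<Rightarrow> nat) \<Rightarrow> nat set \<Rightarrow> bool" where
  "two_ended c X \<longleftrightarrow> (\<forall>v \<in> c ` X. card {i \<in> X. c i = v} = 2)"

lemma chord_diagram_two_ended:
  assumes "distinct L"
  shows "chord_diagram (map c L) \<longleftrightarrow> two_ended c (set L)"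
proof -
  have "count_list (map c L) v = card {i \<in> set L. c i = v}" for v
  proof -
    have "count_list (map c L) v = length (filter (\<lambda>i. c i = v) L)"
      by (simp add: count_list_eq_length_filter filter_map comp_def eq_commute[of v])
    also have "\<dots> = card (set (filter (\<lambda>i. c i = v) L))"
      using assms by (metis distinct_card distinct_filter)
    finally show ?thesis by simp
  qed
  then show ?thesis by (simp add: chord_diagram_def two_ended_def)
qed

text \<open>Every half-edge other than the two extreme ones has exactly one partner along the path.\<close>

lemma path_balance:
  fixes S :: "half_edge set"
  assumes "L \<noteq> []" "\<And>a b. (a, b) \<in> path L \<Longrightarrow> a \<in> S \<longleftrightarrow> b \<in> S"
  shows "(\<Sum>i\<leftarrow>L. of_bool (Leaving i \<in> S)) + of_bool (Entering (hd L) \<in> S) =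
    (\<Sum>i\<leftarrow>L. of_bool (Entering i \<in> S)) + (of_bool (Leaving (last L) \<in> S) :: nat)"
  using assms
proof (induction L rule: path.induct)
  case (1 x y zs)
  have "Leaving x \<in> S \<longleftrightarrow> Entering y \<in> S"
    by (rule 1(3)) simp
  moreover have "(\<Sum>i\<leftarrow>y # zs. of_bool (Leaving i \<in> S)) + of_bool (Entering (hd (y # zs)) \<in> S) =
    (\<Sum>i\<leftarrow>y # zs. of_bool (Entering i \<in> S)) + (of_bool (Leaving (last (y # zs)) \<in> S) :: nat)"
    by (rule 1(1)) (use 1(3) in auto)
  ultimately show ?case by simp
qed auto

text \<open>A set closed under the pairing contains 0, 2 or 4 of the four half-edges at each chord,
  whatever its type; the sum is taken chord by chord.\<close>

lemma pairing_even:
  fixes S :: "half_edge set"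
  assumes X: "finite X" "two_ended c X"
    and S: "\<And>a b. (a, b) \<in> pairing X c \<sigma> \<Longrightarrow> a \<in> S \<longleftrightarrow> b \<in> S"
  shows "even (\<Sum>i\<in>X. of_bool (Entering i \<in> S) + of_bool (Leaving i \<in> S) :: nat)"
proof -
  let ?g = "\<lambda>i. of_bool (Entering i \<in> S) + of_bool (Leaving i \<in> S) :: nat"
  have "even (sum ?g {i \<in> X. c i = v})" if v: "v \<in> c ` X" for v
  proof -
    obtain i j where ij: "i \<noteq> j" "{i \<in> X. c i = v} = {i, j}"
      using X(2) v by (auto simp: two_ended_def card_2_iff)
    then have "i \<in> X" "j \<in> X" "c i = v" "c j = v" by auto
    then show ?thesis
      using ij S[of "Entering i" "Leaving i"] S[of "Entering j" "Leaving j"]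
        S[of "Entering i" "Leaving j"] S[of "Entering j" "Leaving i"]
        S[of "Entering i" "Entering j"] S[of "Leaving i" "Leaving j"]
      by (cases "\<sigma> v") auto
  qed
  then have "even (\<Sum>v\<in>c ` X. sum ?g {i \<in> X. c i = v})"
    by (rule dvd_sum)
  then show ?thesis
    by (simp only: sum.image_gen[OF X(1), of ?g c])
qed

text \<open>Let \<open>S\<close> be the component of the last half-edge. Every chord contributes an
  even number of half-edges to \<open>S\<close>, whereas the arcs of the open path match leaving
  with entering half-edges, all but the two extreme ones. So \<open>S\<close> contains an even
  number of extremes, and hence the first one as well.\<close>

lemma cut_ends_connected:
  assumes "distinct L" "L \<noteq> []" "two_ended c (set L)"
  shows "(Leaving (last L), Entering (hd L)) \<in> conn (path L \<union> pairing (set L) c \<sigma>)"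
proof -
  let ?E = "path L \<union> pairing (set L) c \<sigma>"
  define S where "S = conn ?E `` {Leaving (last L)}"
  have closed: "a \<in> S \<longleftrightarrow> b \<in> S" if "(a, b) \<in> ?E" for a b
    unfolding S_def using that by (auto intro: conn_trans conn_base conn_base')
  have "even (\<Sum>i\<in>set L. of_bool (Entering i \<in> S) + of_bool (Leaving i \<in> S) :: nat)"
    by (rule pairing_even[where c = c and \<sigma> = \<sigma>]) (use assms closed in auto)
  then have "even ((\<Sum>i\<leftarrow>L. of_bool (Entering i \<in> S)) + (\<Sum>i\<leftarrow>L. of_bool (Leaving i \<in> S)) :: nat)"
    using assms(1) by (simp add: sum_list_distinct_conv_sum_set sum.distrib)
  moreover have "(\<Sum>i\<leftarrow>L. of_bool (Leaving i \<in> S)) + of_bool (Entering (hd L) \<in> S) =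
    (\<Sum>i\<leftarrow>L. of_bool (Entering i \<in> S)) + (of_bool (Leaving (last L) \<in> S) :: nat)"
    by (rule path_balance) (use assms closed in auto)
  moreover have "Leaving (last L) \<in> S" by (simp add: S_def)
  ultimately have "Entering (hd L) \<in> S"
    by (auto simp: of_bool_def split: if_splits)
  then show ?thesis by (simp add: S_def)
qed

text \<open>The closing arc joins two half-edges that are already connected, so cutting the circle
  open does not change the number of components.\<close>

lemma circles_path:
  assumes "distinct L" "L \<noteq> []" "two_ended c (set L)"
  shows "circles L (pairing (set L) c \<sigma>) =
    comps (halves (set L)) (path L \<union> pairing (set L) c \<sigma>)"
  using assms cut_ends_connected[OF assms]
  by (simp add: circles_def comps_def arcs_def conn_insert_redundant)

text \<open>Gluing adds two arcs to the disjoint open diagrams. The arc from \<open>?l1\<close> to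
  \<open>?e2\<close> merges two components; the arc from \<open>?l2\<close> to \<open>?e1\<close> is
  then redundant, as each open diagram already connects its own extremes.\<close>

lemma circles_append:
  assumes L: "distinct (L1 @ L2)" "L1 \<noteq> []" "L2 \<noteq> []"
    and two: "two_ended c (set L1)" "two_ended c (set L2)"
    and disj: "c ` set L1 \<inter> c ` set L2 = {}"
  shows "Suc (circles (L1 @ L2) (pairing (set (L1 @ L2)) c \<sigma>)) =
    circles L1 (pairing (set L1) c \<sigma>) + circles L2 (pairing (set L2) c \<sigma>)"
proof -
  let ?V1 = "halves (set L1)" and ?V2 = "halves (set L2)"
  let ?E1 = "path L1 \<union> pairing (set L1) c \<sigma>" and ?E2 = "path L2 \<union> pairing (set L2) c \<sigma>"
  let ?l1 = "Leaving (last L1)" and ?l2 = "Leaving (last L2)"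
  let ?e1 = "Entering (hd L1)" and ?e2 = "Entering (hd L2)"
  let ?F = "insert (?l1, ?e2) (?E1 \<union> ?E2)"
  have sub: "?E1 \<subseteq> ?V1 \<times> ?V1" "?E2 \<subseteq> ?V2 \<times> ?V2"
    using path_subset[of L1] path_subset[of L2]
      pairing_subset[of "set L1" c \<sigma>] pairing_subset[of "set L2" c \<sigma>]
    unfolding halves_def by blast+
  have V: "?V1 \<inter> ?V2 = {}" using L(1) by (auto simp: halves_def)
  have ends: "(?l1, ?e1) \<in> conn ?E1" "(?l2, ?e2) \<in> conn ?E2"
    using cut_ends_connected L two by auto
  have "conn ?E1 \<subseteq> conn ?F" "conn ?E2 \<subseteq> conn ?F"
    by (rule conn_superset, blast)+
  then have "(?l2, ?e2) \<in> conn ?F" "(?l1, ?e1) \<in> conn ?F" using ends by auto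
  moreover have "(?e2, ?l1) \<in> conn ?F" by (rule conn_base') simp
  ultimately have "(?l2, ?e1) \<in> conn ?F" by (blast intro: conn_trans)
  then have F: "conn (insert (?l2, ?e1) ?F) = conn ?F" by (rule conn_insert_redundant)
  have "insert (?l2, ?e1) ?F = arcs (L1 @ L2) \<union> pairing (set (L1 @ L2)) c \<sigma>"
    using L disj by (auto simp: arcs_def path_append pairing_Un)
  then have "circles (L1 @ L2) (pairing (set (L1 @ L2)) c \<sigma>) = comps (?V1 \<union> ?V2) ?F"
    using L F by (simp add: circles_def comps_def halves_Un)
  moreover have "comps (?V1 \<union> ?V2) (?E1 \<union> ?E2) = Suc (comps (?V1 \<union> ?V2) ?F)"
  proof (rule comps_insert_bridge)
    show "(?l1, ?e2) \<notin> conn (?E1 \<union> ?E2)"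
    proof
      assume "(?l1, ?e2) \<in> conn (?E1 \<union> ?E2)"
      then have "?e2 \<in> ?V1"
        by (rule conn_closed) (use L sub V in auto)
      moreover have "?e2 \<in> ?V2" using L(3) by simp
      ultimately show False using V by blast
    qed
  qed (use L in auto)
  moreover have "comps (?V1 \<union> ?V2) (?E1 \<union> ?E2) = comps ?V1 ?E1 + comps ?V2 ?E2"
    by (rule comps_Un) (use sub V in auto)
  ultimately show ?thesis
    using circles_path[of L1 c \<sigma>] circles_path[of L2 c \<sigma>] L two by simp
qed

lemma Z_Nil [simp]: "Z [] c = 1"
  by (simp add: Z_def state_weight_def circles_def)

lemma Z_append:
  assumes L: "distinct (L1 @ L2)"
    and two: "two_ended c (set L1)" "two_ended c (set L2)"
    and disj: "c ` set L1 \<inter> c ` set L2 = {}"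
  shows "Z (L1 @ L2) c = Z L1 c * Z L2 c"
proof (cases "L1 = [] \<or> L2 = []")
  case False
  let ?S1 = "c ` set L1" and ?S2 = "c ` set L2"
  let ?t = "\<lambda>L \<sigma>. state_weight (c ` set L) \<sigma> * var_x ^ (circles L (pairing (set L) c \<sigma>) - 1)"
  \<comment> \<open>A term sees only the types of the chords of its own factor, so a glued state may
    replace the state it was glued from.\<close>
  have local_t: "?t L \<sigma> = ?t L \<sigma>'" if "\<And>v. v \<in> c ` set L \<Longrightarrow> \<sigma> v = \<sigma>' v" for L \<sigma> \<sigma>'
  proof -
    have "state_weight (c ` set L) \<sigma> = state_weight (c ` set L) \<sigma>'"
      unfolding state_weight_def by (rule prod.cong) (use that in auto)
    moreover have "pairing (set L) c \<sigma> = pairing (set L) c \<sigma>'"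
      by (rule pairing_cong) (use that in auto)
    ultimately show ?thesis by simp
  qed
  have t: "?t (L1 @ L2) \<sigma> = ?t L1 \<sigma> * ?t L2 \<sigma>" for \<sigma>
  proof -
    \<comment> \<open>Truncated subtraction does no harm, since both factors have at least one
      circle.\<close>
    have "circles (L1 @ L2) (pairing (set (L1 @ L2)) c \<sigma>) - 1 =
        (circles L1 (pairing (set L1) c \<sigma>) - 1) + (circles L2 (pairing (set L2) c \<sigma>) - 1)"
      using circles_append[OF L _ _ two disj, of \<sigma>] False
        circles_pos[of L1 "pairing (set L1) c \<sigma>"] circles_pos[of L2 "pairing (set L2) c \<sigma>"]
      by linarith
    moreover have "state_weight (c ` set (L1 @ L2)) \<sigma> = state_weight ?S1 \<sigma> * state_weight ?S2 \<sigma>"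
      unfolding state_weight_def using disj by (simp add: image_Un prod.union_disjoint)
    ultimately show ?thesis by (simp only: power_add mult_ac)
  qed
  have "Z L1 c * Z L2 c = (\<Sum>p \<in> (?S1 \<rightarrow>\<^sub>E UNIV) \<times> (?S2 \<rightarrow>\<^sub>E UNIV). ?t L1 (fst p) * ?t L2 (snd p))"
    by (simp add: Z_def sum_product sum.cartesian_product case_prod_beta)
  also have "\<dots> = (\<Sum>\<sigma> \<in> c ` set (L1 @ L2) \<rightarrow>\<^sub>E UNIV. ?t (L1 @ L2) \<sigma>)"
  proof (rule sum.reindex_bij_witness[where
        i = "\<lambda>\<sigma>. (restrict \<sigma> ?S1, restrict \<sigma> ?S2)"
        and j = "\<lambda>p v. if v \<in> ?S1 then fst p v else snd p v"])
    fix p assume p: "p \<in> (?S1 \<rightarrow>\<^sub>E (UNIV :: ttype set)) \<times> (?S2 \<rightarrow>\<^sub>E (UNIV :: ttype set))"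
    let ?\<sigma> = "\<lambda>v. if v \<in> ?S1 then fst p v else snd p v"
    have S2: "v \<notin> ?S1" if "v \<in> ?S2" for v using that disj by blast
    have eq: "restrict ?\<sigma> ?S1 = fst p" "restrict ?\<sigma> ?S2 = snd p"
      using p S2 by (auto simp: fun_eq_iff PiE_def extensional_def restrict_def)
    then show "(restrict ?\<sigma> ?S1, restrict ?\<sigma> ?S2) = p" by simp
    show "?\<sigma> \<in> c ` set (L1 @ L2) \<rightarrow>\<^sub>E UNIV"
      using p by (auto simp: PiE_def extensional_def)
    have "?t L1 ?\<sigma> = ?t L1 (fst p)" "?t L2 ?\<sigma> = ?t L2 (snd p)"
      by (rule local_t; use S2 in auto)+
    then show "?t (L1 @ L2) ?\<sigma> = ?t L1 (fst p) * ?t L2 (snd p)"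
      using t[of ?\<sigma>] by simp
  next
    fix \<sigma> assume \<sigma>: "\<sigma> \<in> c ` set (L1 @ L2) \<rightarrow>\<^sub>E (UNIV :: ttype set)"
    then show "(\<lambda>v. if v \<in> ?S1 then fst (restrict \<sigma> ?S1, restrict \<sigma> ?S2) v
        else snd (restrict \<sigma> ?S1, restrict \<sigma> ?S2) v) = \<sigma>"
      by (auto simp: fun_eq_iff PiE_def extensional_def restrict_def)
  qed auto
  finally show ?thesis by (simp add: Z_def)
qed auto

lemma Q_append:
  assumes "chord_diagram u" "chord_diagram v" "set u \<inter> set v = {}"
  shows "chord_diagram (u @ v)" "Q (u @ v) = Q u * Q v"
proof -
  have "count_list (u @ v) a = 2" if "a \<in> set (u @ v)" for a
    using that assms by (auto simp: chord_diagram_def count_list_append count_list_0_iff)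
  then show uv: "chord_diagram (u @ v)" by (simp add: chord_diagram_def)
  obtain L and c :: "nat \<Rightarrow> nat" where L: "distinct L" "map c L = u @ v"
    by (rule word_labelling)
  then obtain L1 L2 where L12: "L = L1 @ L2" "map c L1 = u" "map c L2 = v"
    by (auto simp: map_eq_append_conv)
  then have d: "distinct L1" "distinct L2" using L by auto
  have two: "two_ended c (set L1)" "two_ended c (set L2)"
    using chord_diagram_two_ended d L12 assms by auto
  have "c ` set L1 \<inter> c ` set L2 = {}"
    using assms(3) L12(2,3)[symmetric] by simp
  then have "Z (L1 @ L2) c = Z L1 c * Z L2 c"
    by (intro Z_append) (use L L12 two in auto)
  moreover have "Q (u @ v) = Z (L1 @ L2) c"
    using Q_eq_Z[of c L] L L12 uv by simp
  moreover have "Q u = Z L1 c" "Q v = Z L2 c"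
    using Q_eq_Z[of c L1] Q_eq_Z[of c L2] d L12 assms by auto
  ultimately show "Q (u @ v) = Q u * Q v" by simp
qed

lemma Q_product:
  assumes "chord_diagram C1" "chord_diagram C2" "is_product C1 C2 C"
  shows "Q C = Q C1 * Q C2"
proof -
  obtain u v where uv: "diagram_iso C1 u" "diagram_iso C2 v" "set u \<inter> set v = {}"
    "diagram_iso (u @ v) C"
    using assms(3) by (auto simp: is_product_def)
  have "chord_diagram u" "chord_diagram v"
    using chord_diagram_iso assms uv by auto
  then have "Q (u @ v) = Q u * Q v" "Q (u @ v) = Q C"
    using Q_append[of u v] Q_iso[of "u @ v" C] uv(3,4) by auto
  then show ?thesis
    using Q_iso[of C1 u] Q_iso[of C2 v] assms(1,2) uv(1,2) by simp
qed

section \<open>Resolving a chord\<close>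

lemma comps_swap:
  fixes a a' :: 'a
  defines "\<pi> \<equiv> (\<lambda>h. if h = a then a' else if h = a' then a else h)"
  assumes E: "\<And>x y. (x, y) \<in> E \<Longrightarrow> (\<pi> x, \<pi> y) \<in> E' \<union> E'\<inverse>"
    and E': "\<And>x y. (x, y) \<in> E' \<Longrightarrow> (\<pi> x, \<pi> y) \<in> E \<union> E\<inverse>"
    and V: "a \<in> V" "a' \<in> V"
  shows "comps V E = comps V E'"
proof (rule comps_eqI[where f = \<pi> and g = \<pi>])
  show "(\<pi> x, \<pi> y) \<in> conn E'" if "(x, y) \<in> E" for x y
    using E[OF that] by (auto intro: conn_base conn_base')
  show "(\<pi> x, \<pi> y) \<in> conn E" if "(x, y) \<in> E'" for x y
    using E'[OF that] by (auto intro: conn_base conn_base')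
qed (use V in \<open>auto simp: \<pi>_def\<close>)

text \<open>The half-edges \<open>e1\<close>, \<open>l1\<close>, \<open>e2\<close>, \<open>l2\<close> enter and leave $B_1$ and $B_2$, and \<open>ea\<close>, \<open>la\<close> enter and
  leave $A$; the strand between $B_1$ and $B_2$ runs from \<open>p\<close> to \<open>q\<close>, the other one from \<open>r\<close> to \<open>z\<close>.\<close>

locale strands =
  fixes V :: "'a set" and N :: "'a rel" and e1 l1 e2 l2 ea la p q r z :: 'a
  assumes V: "{ea, la, p, q, r, z} \<subseteq> V - {e1, l1, e2, l2}"
    and b_distinct: "distinct [e1, l1, e2, l2]"
    and N: "Field N \<inter> {e1, l1, e2, l2} = {}"
begin

abbreviation "K \<equiv> V - {e1, l1, e2, l2}"

text \<open>In each diagram these are the arcs that touch \<open>A\<close>, \<open>B1\<close> or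
  \<open>B2\<close>. What the four diagrams share, namely the interiors of the strands and the
  transitions of all chords except b, is in \<open>N\<close>.\<close>

abbreviation "arcs_C \<equiv> {(z, ea), (la, e1), (l1, p), (q, e2), (l2, r)}"
abbreviation "arcs_C' \<equiv> {(z, e1), (l1, ea), (la, p), (q, e2), (l2, r)}"
abbreviation "arcs_D \<equiv> {(l1, p), (q, e2), (l2, ea), (la, r), (z, e1)}"
abbreviation "arcs_D' \<equiv> {(l1, p), (q, ea), (la, e2), (l2, r), (z, e1)}"

abbreviation "b_phi \<equiv> {(e1, l1), (e2, l2)}"
abbreviation "b_chi \<equiv> {(e1, l2), (e2, l1)}"
abbreviation "b_psi \<equiv> {(e1, e2), (l1, l2)}"

text \<open>With b of type \<phi> the strand passes straight through both of its ends, as if b were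
  deleted. What remains is whether A lies between \<open>z\<close> and \<open>p\<close> or between
  \<open>q\<close> and \<open>r\<close>.\<close>

lemma phi:
  "comps V (N \<union> arcs_C \<union> b_phi) = comps K (N \<union> {(z, ea), (la, p), (q, r)})"
  "comps V (N \<union> arcs_C' \<union> b_phi) = comps K (N \<union> {(z, ea), (la, p), (q, r)})"
  "comps V (N \<union> arcs_D \<union> b_phi) = comps K (N \<union> {(z, p), (q, ea), (la, r)})"
  "comps V (N \<union> arcs_D' \<union> b_phi) = comps K (N \<union> {(z, p), (q, ea), (la, r)})"
  subgoal
    by (rule comps_contract2_cong[OF _ _ refl _ _ _ _ _ _ refl, of _ "N \<union> {(z, ea)}" la e1 l1 p q e2 l2 r])
      (use V b_distinct N in auto)
  subgoal
    by (rule comps_contract2_cong[OF _ _ refl _ _ _ _ _ _ refl, of _ "N \<union> {(la, p)}" z e1 l1 ea q e2 l2 r])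
      (use V b_distinct N in auto)
  subgoal
    by (rule comps_contract2_cong[OF _ _ refl _ _ _ _ _ _ refl, of _ "N \<union> {(la, r)}" z e1 l1 p q e2 l2 ea])
      (use V b_distinct N in auto)
  subgoal
    by (rule comps_contract2_cong[OF _ _ refl _ _ _ _ _ _ refl, of _ "N \<union> {(q, ea)}" z e1 l1 p la e2 l2 r])
      (use V b_distinct N in auto)
  done

text \<open>Type \<chi> continues \<open>z\<close> to \<open>r\<close> and \<open>q\<close> to
  \<open>p\<close>. In \<open>arcs_C\<close> and \<open>arcs_D\<close> the end A lies on the first
  of these strands, before or after b; in \<open>arcs_C'\<close> and \<open>arcs_D'\<close> it lies
  on the second.\<close>

lemma chi:
  "comps V (N \<union> arcs_C \<union> b_chi) = comps K (N \<union> {(z, ea), (la, r), (q, p)})"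
  "comps V (N \<union> arcs_D \<union> b_chi) = comps K (N \<union> {(z, ea), (la, r), (q, p)})"
  "comps V (N \<union> arcs_C' \<union> b_chi) = comps K (N \<union> {(z, r), (q, ea), (la, p)})"
  "comps V (N \<union> arcs_D' \<union> b_chi) = comps K (N \<union> {(z, r), (q, ea), (la, p)})"
  subgoal
    by (rule comps_contract2_cong[OF _ _ refl _ _ _ _ _ _ refl, of _ "N \<union> {(z, ea)}" la e1 l2 r q e2 l1 p])
      (use V b_distinct N in auto)
  subgoal
    by (rule comps_contract2_cong[OF _ _ refl _ _ _ _ _ _ refl, of _ "N \<union> {(la, r)}" z e1 l2 ea q e2 l1 p])
      (use V b_distinct N in auto)
  subgoal
    by (rule comps_contract2_cong[OF _ _ refl _ _ _ _ _ _ refl, of _ "N \<union> {(la, p)}" z e1 l2 r q e2 l1 ea])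
      (use V b_distinct N in auto)
  subgoal
    by (rule comps_contract2_cong[OF _ _ refl _ _ _ _ _ _ refl, of _ "N \<union> {(q, ea)}" z e1 l2 r la e2 l1 p])
      (use V b_distinct N in auto)
  done

text \<open>Type \<psi> joins \<open>z\<close> with \<open>q\<close> and \<open>p\<close> with
  \<open>r\<close>. In \<open>arcs_C\<close> and \<open>arcs_D'\<close> the end A lies on the first
  strand, in \<open>arcs_C'\<close> and \<open>arcs_D\<close> on the second; within each pair
  \<open>ea\<close> and \<open>la\<close> have changed places.\<close>

lemma psi:
  "comps V (N \<union> arcs_C \<union> b_psi) = comps K (N \<union> {(z, ea), (la, q), (p, r)})"
  "comps V (N \<union> arcs_D' \<union> b_psi) = comps K (N \<union> {(q, ea), (z, la), (p, r)})"
  "comps V (N \<union> arcs_C' \<union> b_psi) = comps K (N \<union> {(la, p), (z, q), (ea, r)})"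
  "comps V (N \<union> arcs_D \<union> b_psi) = comps K (N \<union> {(la, r), (z, q), (p, ea)})"
  subgoal
    by (rule comps_contract2_cong[OF _ _ refl _ _ _ _ _ _ refl, of _ "N \<union> {(z, ea)}" la e1 e2 q p l1 l2 r])
      (use V b_distinct N in auto)
  subgoal
    by (rule comps_contract2_cong[OF _ _ refl _ _ _ _ _ _ refl, of _ "N \<union> {(q, ea)}" z e1 e2 la p l1 l2 r])
      (use V b_distinct N in auto)
  subgoal
    by (rule comps_contract2_cong[OF _ _ refl _ _ _ _ _ _ refl, of _ "N \<union> {(la, p)}" z e1 e2 q ea l1 l2 r])
      (use V b_distinct N in auto)
  subgoal
    by (rule comps_contract2_cong[OF _ _ refl _ _ _ _ _ _ refl, of _ "N \<union> {(la, r)}" z e1 e2 q p l1 l2 ea])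
      (use V b_distinct N in auto)
  done

end

text \<open>If a has type \<phi>, the edge between \<open>ea\<close> and \<open>la\<close> is the
  only one of \<open>N\<close> at these two half-edges, so A can be contracted after b has
  been.\<close>

locale strands_a_phi = strands +
  fixes N1
  assumes N1: "N = insert (ea, la) N1" "Field N1 \<inter> {ea, la} = {}"
    and a_ends: "ea \<noteq> la" "{p, q, r, z} \<inter> {ea, la} = {}"
begin

text \<open>Once A is erased, only the reconnection at b is visible: one result for type \<chi> and
  one for type \<psi>. Type \<phi> of b is absent because \<open>phi\<close> already equates the
  required diagrams.\<close>

lemma contract_a:
  "comps K (N \<union> {(z, ea), (la, r), (q, p)}) = comps (K - {ea, la}) (N1 \<union> {(z, r), (q, p)})"
  "comps K (N \<union> {(z, r), (q, ea), (la, p)}) = comps (K - {ea, la}) (N1 \<union> {(z, r), (q, p)})"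
  "comps K (N \<union> {(z, ea), (la, q), (p, r)}) = comps (K - {ea, la}) (N1 \<union> {(z, q), (p, r)})"
  "comps K (N \<union> {(q, ea), (z, la), (p, r)}) = comps (K - {ea, la}) (N1 \<union> {(z, q), (p, r)})"
  "comps K (N \<union> {(la, p), (z, q), (ea, r)}) = comps (K - {ea, la}) (N1 \<union> {(z, q), (p, r)})"
  "comps K (N \<union> {(la, r), (z, q), (p, ea)}) = comps (K - {ea, la}) (N1 \<union> {(z, q), (p, r)})"
  subgoal
    by (rule comps_contract_cong[OF _ _ refl _ _ _ _ _ refl, of _ "N1 \<union> {(q, p)}" z ea la r])
      (use V N1 a_ends in auto)
  subgoal
    by (rule comps_contract_cong[OF _ _ refl _ _ _ _ _ refl, of _ "N1 \<union> {(z, r)}" q ea la p])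
      (use V N1 a_ends in auto)
  subgoal
    by (rule comps_contract_cong[OF _ _ refl _ _ _ _ _ refl, of _ "N1 \<union> {(p, r)}" z ea la q])
      (use V N1 a_ends in auto)
  subgoal
    by (rule comps_contract_cong[OF _ _ refl _ _ _ _ _ refl, of _ "N1 \<union> {(p, r)}" z la ea q])
      (use V N1 a_ends in auto)
  subgoal
    by (rule comps_contract_cong[OF _ _ refl _ _ _ _ _ refl, of _ "N1 \<union> {(z, q)}" p la ea r])
      (use V N1 a_ends in auto)
  subgoal
    by (rule comps_contract_cong[OF _ _ refl _ _ _ _ _ refl, of _ "N1 \<union> {(z, q)}" p ea la r])
      (use V N1 a_ends in auto)
  done

lemma a_phi:
  assumes "b \<in> {b_phi, b_chi, b_psi}"
  shows "comps V (N \<union> arcs_C \<union> b) = comps V (N \<union> arcs_C' \<union> b)"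
    "comps V (N \<union> arcs_D \<union> b) = comps V (N \<union> arcs_D' \<union> b)"
  using assms by (auto simp only: insert_iff empty_iff phi chi psi contract_a)

end

section \<open>Markers and change of type\<close>

text \<open>A marker is an extra point of the circle that is an end of no chord. Markers make the two strands
  of a four-term relation nonempty, which spares all case distinctions.\<close>

lemma circles_marker:
  assumes L: "xs @ ys \<noteq> []" "m \<notin> set (xs @ ys)"
    and M: "M \<subseteq> halves (set (xs @ ys)) \<times> halves (set (xs @ ys))"
  shows "circles (xs @ [m] @ ys) (insert (Entering m, Leaving m) M) = circles (xs @ ys) M"
proof -
  \<comment> \<open>The circle is rotated so that the marker comes last; its two arcs then replace
    the closing arc of \<open>L\<close>.\<close>
  define L where "L = ys @ xs"
  have L': "L \<noteq> []" "m \<notin> set L" "set L = set (xs @ ys)" "M \<subseteq> halves (set L) \<times> halves (set L)"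
    using L M by (auto simp: L_def Un_commute)
  have "arcs (xs @ [m] @ ys) = arcs (L @ [m])"
    using arcs_rotate[of xs "[m] @ ys"] arcs_rotate[of "[m]" L] by (simp add: L_def)
  also have "\<dots> = path L \<union> {(Leaving (last L), Entering m), (Leaving m, Entering (hd L))}"
    using L' by (auto simp: arcs_def path_append)
  finally have arcs: "arcs (xs @ [m] @ ys) = \<dots>" .
  have "path L \<subseteq> halves (set L) \<times> halves (set L)"
    using path_subset[of L] unfolding halves_def by blast
  then have F: "Field (path L \<union> M) \<subseteq> halves (set L)"
    using L'(4) unfolding Field_def by blast
  have "circles (xs @ [m] @ ys) (insert (Entering m, Leaving m) M) =
      comps (halves (insert m (set L)))
        ((path L \<union> M) \<union> {(Leaving (last L), Entering m), (Entering m, Leaving m), (Leaving m, Entering (hd L))})"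
    unfolding circles_def arcs using L' by (simp add: insert_commute Un_ac)
  also have "\<dots> = comps (halves (insert m (set L)) - {Entering m, Leaving m})
      ((path L \<union> M) \<union> {(Leaving (last L), Entering (hd L))})"
    by (rule comps_contract) (use F L' in \<open>auto simp: last_in_set hd_in_set\<close>)
  also have "halves (insert m (set L)) - {Entering m, Leaving m} = halves (set L)"
    using L'(2) by (auto simp: halves_def)
  also have "(path L \<union> M) \<union> {(Leaving (last L), Entering (hd L))} = arcs (xs @ ys) \<union> M"
    using L' arcs_rotate[of xs ys] by (auto simp: arcs_def L_def)
  finally show ?thesis
    using L(1) L'(3) by (auto simp: circles_def)
qed

lemma circles_two_markers:
  assumes L: "as \<noteq> []" "m1 \<notin> set (as @ us @ bs @ vs)" "m2 \<notin> set (as @ us @ bs @ vs)" "m1 \<noteq> m2"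
    and M: "M \<subseteq> halves (set (as @ us @ bs @ vs)) \<times> halves (set (as @ us @ bs @ vs))"
  shows "circles (as @ (us @ [m1]) @ bs @ (vs @ [m2]))
      ({(Entering m1, Leaving m1), (Entering m2, Leaving m2)} \<union> M) = circles (as @ us @ bs @ vs) M"
proof -
  let ?M = "insert (Entering m2, Leaving m2) M"
  have "circles ((as @ us) @ [m1] @ (bs @ vs @ [m2])) (insert (Entering m1, Leaving m1) ?M) =
      circles ((as @ us) @ (bs @ vs @ [m2])) ?M"
    by (rule circles_marker) (use L M in \<open>auto simp: halves_def\<close>)
  also have "\<dots> = circles ((as @ us @ bs @ vs) @ [m2] @ []) ?M" by simp
  also have "\<dots> = circles ((as @ us @ bs @ vs) @ []) M"
    by (rule circles_marker) (use L M in auto)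
  finally show ?thesis by simp
qed

fun swap_type :: "ttype \<Rightarrow> ttype" where
  "swap_type Phi = Phi" | "swap_type Chi = Psi" | "swap_type Psi = Chi"

lemma swap_type_involution [simp]: "swap_type (swap_type \<tau>) = \<tau>"
  by (cases \<tau>) auto

definition flip :: "nat \<Rightarrow> (nat \<Rightarrow> ttype) \<Rightarrow> nat \<Rightarrow> ttype" where
  "flip a \<sigma> = \<sigma>(a := swap_type (\<sigma> a))"

lemma flip_involution [simp]: "flip a (flip a \<sigma>) = \<sigma>"
  by (simp add: flip_def)

lemma flip_apply: "flip a \<sigma> v = (if v = a then swap_type (\<sigma> v) else \<sigma> v)"
  by (simp add: flip_def)

lemma swap_type_eq_iff [simp]: "swap_type \<tau> = Phi \<longleftrightarrow> \<tau> = Phi"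
  by (cases \<tau>) auto

text \<open>The factor at \<open>a\<close> changes sign because \<chi> and \<psi> have weights
  \<open>- var_t\<close> and \<open>var_t\<close>; type \<phi> is fixed by \<open>swap_type\<close>
  and must be excluded.\<close>

lemma state_weight_flip:
  assumes "finite S" "a \<in> S" "\<sigma> a \<noteq> Phi"
  shows "state_weight S (flip a \<sigma>) = - state_weight S \<sigma>"
proof -
  have "weight (swap_type (\<sigma> a)) = - weight (\<sigma> a)"
    using assms(3) by (cases "\<sigma> a") auto
  moreover have "(\<Prod>v\<in>S - {a}. weight (flip a \<sigma> v)) = (\<Prod>v\<in>S - {a}. weight (\<sigma> v))"
    by (rule prod.cong) (auto simp: flip_def)
  ultimately show ?thesis
    using assms(1,2) by (simp add: state_weight_def prod.remove[of S a] flip_apply)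
qed

text \<open>Exchanging the half-edges at \<open>A\<close> alone turns the \<chi> pairs of
  \<open>A\<close> and \<open>A'\<close> into \<open>{Leaving A, Leaving A'}\<close> and
  \<open>{Entering A, Entering A'}\<close>, the \<psi> pairs, and conversely. Some images come out
  in the opposite direction, whence the converse.\<close>

lemma pairing_flip:
  fixes A :: nat
  defines "\<pi> \<equiv> (\<lambda>h. if h = Entering A then Leaving A else if h = Leaving A then Entering A else h)"
  assumes A: "{i \<in> Y. c i = c A} = {A, A'}" "A \<noteq> A'"
    and \<sigma>: "\<sigma> (c A) \<noteq> Phi"
    and xy: "(x, y) \<in> pairing Y c \<sigma>"
  shows "(\<pi> x, \<pi> y) \<in> pairing Y c (flip (c A) \<sigma>) \<union> (pairing Y c (flip (c A) \<sigma>))\<inverse>"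
proof -
  have in_Y: "A \<in> Y" "A' \<in> Y" "c A' = c A" using A(1) by blast+
  have Y: "i \<in> {A, A'}" if "i \<in> Y" "c i = c A" for i using A(1) that by blast
  obtain i j where ij: "i \<in> Y" "j \<in> Y" "c i = c j" "x \<in> {Entering i, Leaving i}" "y \<in> {Entering j, Leaving j}"
    using xy by (cases x; cases y) auto
  show ?thesis
  proof (cases "c i = c A")
    case True
    then have "i \<in> {A, A'}" "j \<in> {A, A'}"
      using Y[OF ij(1)] Y[OF ij(2)] ij(3) by auto
    with ij(4,5) have "x \<in> {Entering A, Leaving A, Entering A', Leaving A'}"
      "y \<in> {Entering A, Leaving A, Entering A', Leaving A'}"
      by blast+
    then show ?thesis
      using xy \<sigma> A(2) in_Y
      by (elim insertE emptyE; cases "\<sigma> (c A)") (simp_all add: \<pi>_def flip_apply)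
  next
    case False
    with ij have "x \<notin> {Entering A, Leaving A}" "y \<notin> {Entering A, Leaving A}" by auto
    then have "\<pi> x = x" "\<pi> y = y" by (auto simp: \<pi>_def)
    moreover have "(x, y) \<in> pairing Y c (flip (c A) \<sigma>)"
      using xy ij(3-5) False by (cases x; cases y) (auto simp: flip_apply)
    ultimately show ?thesis by simp
  qed
qed

section \<open>The four-term relations\<close>

text \<open>\<open>A'\<close> is the other end of a; whether it lies in \<open>us\<close> or in
  \<open>vs\<close> never matters. The fresh points \<open>m1\<close> and \<open>m2\<close> close
  off the two strands.\<close>

locale four_ends =
  fixes A A' B1 B2 m1 m2 :: nat and us vs :: "nat list" and c :: "nat \<Rightarrow> nat" and X :: "nat set"
  assumes X: "X = set ([A, B1] @ us @ [B2] @ vs)"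
    and distinct: "distinct ([A, B1] @ us @ [B2] @ vs)"
    and chord_b: "{i \<in> X. c i = c B1} = {B1, B2}"
    and chord_a: "{i \<in> X. c i = c A} = {A, A'}" "A \<noteq> A'"
    and markers: "m1 \<notin> X" "m2 \<notin> X" "m1 \<noteq> m2"
begin

abbreviation "W \<equiv> halves (X \<union> {m1, m2})"
text \<open>With a marker appended, each strand has a first half-edge even if \<open>us\<close> or
  \<open>vs\<close> is empty. The last half-edges of the strands are \<open>Leaving m1\<close> and
  \<open>Leaving m2\<close>.\<close>

abbreviation "p \<equiv> Entering (hd (us @ [m1]))"
abbreviation "r \<equiv> Entering (hd (vs @ [m2]))"
abbreviation "Y \<equiv> X - {B1, B2}"

definition base :: "half_edge rel" where
  "base = path (us @ [m1]) \<union> path (vs @ [m2]) \<union> {(Entering m1, Leaving m1), (Entering m2, Leaving m2)}"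

definition rest :: "(nat \<Rightarrow> ttype) \<Rightarrow> half_edge rel" where
  "rest \<sigma> = base \<union> pairing Y c \<sigma>"

fun b_part :: "ttype \<Rightarrow> half_edge rel" where
  "b_part Phi = {(Entering B1, Leaving B1), (Entering B2, Leaving B2)}"
| "b_part Chi = {(Entering B1, Leaving B2), (Entering B2, Leaving B1)}"
| "b_part Psi = {(Entering B1, Entering B2), (Leaving B1, Leaving B2)}"

abbreviation "kC \<sigma> \<equiv> circles ([A, B1] @ us @ [B2] @ vs) (pairing X c \<sigma>)"
abbreviation "kC' \<sigma> \<equiv> circles ([B1, A] @ us @ [B2] @ vs) (pairing X c \<sigma>)"
abbreviation "kD \<sigma> \<equiv> circles ([B1] @ us @ [B2, A] @ vs) (pairing X c \<sigma>)"
abbreviation "kD' \<sigma> \<equiv> circles ([B1] @ us @ [A, B2] @ vs) (pairing X c \<sigma>)"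

lemma chords_ab: "c B2 = c B1" "c A \<noteq> c B1"
proof -
  have "A \<in> X" using X by simp
  moreover have "B2 \<in> {i \<in> X. c i = c B1}" unfolding chord_b by simp
  moreover have "A \<notin> {i \<in> X. c i = c B1}" unfolding chord_b using distinct by auto
  ultimately show "c B2 = c B1" "c A \<noteq> c B1" by blast+
qed

lemma pairing_split: "pairing X c \<sigma> = pairing Y c \<sigma> \<union> pairing {B1, B2} c \<sigma>"
proof -
  have "B1 \<in> X" "B2 \<in> X" using X by auto
  then have "X = Y \<union> {B1, B2}" by blast
  moreover have "c i \<notin> c ` {B1, B2}" if "i \<in> Y" for i
  proof -
    have "c i \<noteq> c B1" using chord_b that by blast
    then show ?thesis using chords_ab(1) by simp
  qed
  then have "c ` Y \<inter> c ` {B1, B2} = {}" by blast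
  ultimately show ?thesis
    using pairing_Un[of c Y "{B1, B2}" \<sigma>] by simp
qed

lemma pairing_b:
  "pairing {B1, B2} c \<sigma> \<subseteq> b_part (\<sigma> (c B1)) \<union> (b_part (\<sigma> (c B1)))\<inverse>"
  "b_part (\<sigma> (c B1)) \<subseteq> pairing {B1, B2} c \<sigma> \<union> (pairing {B1, B2} c \<sigma>)\<inverse>"
proof -
  have B: "B1 \<noteq> B2" "c B2 = c B1" using distinct chords_ab by auto
  show "b_part (\<sigma> (c B1)) \<subseteq> pairing {B1, B2} c \<sigma> \<union> (pairing {B1, B2} c \<sigma>)\<inverse>"
    using B by (cases "\<sigma> (c B1)") auto
  show "pairing {B1, B2} c \<sigma> \<subseteq> b_part (\<sigma> (c B1)) \<union> (b_part (\<sigma> (c B1)))\<inverse>"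
  proof (rule subrelI)
    fix x y assume xy: "(x, y) \<in> pairing {B1, B2} c \<sigma>"
    then have "x \<in> halves {B1, B2}" "y \<in> halves {B1, B2}"
      using pairing_subset[of "{B1, B2}" c \<sigma>] by auto
    then have "x \<in> {Entering B1, Leaving B1, Entering B2, Leaving B2}"
      "y \<in> {Entering B1, Leaving B1, Entering B2, Leaving B2}"
      by (auto simp: halves_def)
    then show "(x, y) \<in> b_part (\<sigma> (c B1)) \<union> (b_part (\<sigma> (c B1)))\<inverse>"
      using xy B by (elim insertE emptyE; cases "\<sigma> (c B1)") simp_all
  qed
qed

text \<open>One formula for all four diagrams: \<open>as\<close> and \<open>bs\<close> are the
  blocks before the two strands, and \<open>A\<close> is in either block, on either side of the end
  of b. The added markers do not change the count.\<close>

lemma circles_eq_comps: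
  assumes "as \<noteq> []" "bs \<noteq> []" "set as \<union> set us \<union> set bs \<union> set vs = X"
  shows "circles (as @ us @ bs @ vs) (pairing X c \<sigma>) =
    comps W (rest \<sigma> \<union> (path as \<union> path bs \<union> {(Leaving (last as), p), (Leaving m1, Entering (hd bs)),
      (Leaving (last bs), r), (Leaving m2, Entering (hd as))}) \<union> b_part (\<sigma> (c B1)))"
proof -
  let ?M = "{(Entering m1, Leaving m1), (Entering m2, Leaving m2)} \<union> pairing X c \<sigma>"
  let ?L = "as @ (us @ [m1]) @ bs @ (vs @ [m2])"
  have X': "set (as @ us @ bs @ vs) = X" using assms(3) by auto
  have "circles (as @ us @ bs @ vs) (pairing X c \<sigma>) = circles ?L ?M"
    by (rule circles_two_markers[symmetric])
      (use assms(1) markers pairing_subset X' in \<open>simp_all only: X' not_False_eq_True\<close>)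
  also have "\<dots> = comps W (arcs ?L \<union> ?M)"
  proof -
    have "set ?L = X \<union> {m1, m2}" using X' by auto
    then show ?thesis using assms(1) by (simp only: circles_def) simp
  qed
  also have "arcs ?L = path as \<union> path (us @ [m1]) \<union> path bs \<union> path (vs @ [m2]) \<union>
      {(Leaving (last as), p), (Leaving m1, Entering (hd bs)),
      (Leaving (last bs), r), (Leaving m2, Entering (hd as))}"
  proof -
    define us' vs' where "us' = us @ [m1]" and "vs' = vs @ [m2]"
    then have "us' \<noteq> []" "vs' \<noteq> []" "last us' = m1" "last vs' = m2" by auto
    then show ?thesis
      using assms(1,2) unfolding us'_def[symmetric] vs'_def[symmetric]
      by (auto simp: arcs_def path_append)
  qed
  also have "comps W (\<dots> \<union> ?M) = comps W (rest \<sigma> \<union> (path as \<union> path bs \<union> {(Leaving (last as), p), (Leaving m1, Entering (hd bs)),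
      (Leaving (last bs), r), (Leaving m2, Entering (hd as))}) \<union> b_part (\<sigma> (c B1)))"
    by (rule comps_sym_cong)
      (use pairing_b[of \<sigma>] in \<open>unfold pairing_split rest_def base_def, blast+\<close>)
  finally show ?thesis .
qed

lemma circles_expand:
  "kC \<sigma> = comps W (rest \<sigma> \<union> {(Leaving m2, Entering A), (Leaving A, Entering B1), (Leaving B1, p),
     (Leaving m1, Entering B2), (Leaving B2, r)} \<union> b_part (\<sigma> (c B1)))"
  "kC' \<sigma> = comps W (rest \<sigma> \<union> {(Leaving m2, Entering B1), (Leaving B1, Entering A), (Leaving A, p),
     (Leaving m1, Entering B2), (Leaving B2, r)} \<union> b_part (\<sigma> (c B1)))"
  "kD \<sigma> = comps W (rest \<sigma> \<union> {(Leaving B1, p), (Leaving m1, Entering B2), (Leaving B2, Entering A),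
     (Leaving A, r), (Leaving m2, Entering B1)} \<union> b_part (\<sigma> (c B1)))"
  "kD' \<sigma> = comps W (rest \<sigma> \<union> {(Leaving B1, p), (Leaving m1, Entering A), (Leaving A, Entering B2),
     (Leaving B2, r), (Leaving m2, Entering B1)} \<union> b_part (\<sigma> (c B1)))"
  subgoal
    by (subst circles_eq_comps) (use X in \<open>auto simp: insert_commute\<close>)
  subgoal
    by (subst circles_eq_comps) (use X in \<open>auto simp: insert_commute\<close>)
  subgoal
    by (subst circles_eq_comps) (use X in \<open>auto simp: insert_commute\<close>)
  subgoal
    by (subst circles_eq_comps) (use X in \<open>auto simp: insert_commute\<close>)
  done

lemma base_subset: "base \<subseteq> halves (X \<union> {m1, m2} - {A, B1, B2}) \<times> halves (X \<union> {m1, m2} - {A, B1, B2})"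
proof -
  let ?S = "X \<union> {m1, m2} - {A, B1, B2}"
  have path: "path xs \<subseteq> halves ?S \<times> halves ?S" if "set xs \<subseteq> ?S" for xs
    using path_subset[of xs] that unfolding halves_def by blast
  have "set (us @ [m1]) \<subseteq> ?S" "set (vs @ [m2]) \<subseteq> ?S"
    using distinct X markers by auto
  moreover from this have "{(Entering m1, Leaving m1), (Entering m2, Leaving m2)} \<subseteq> halves ?S \<times> halves ?S"
    by simp
  ultimately show ?thesis
    unfolding base_def by (intro Un_least path)
qed

lemma base_avoids:
  assumes "(x, y) \<in> base"
  shows "x \<notin> halves {A, B1, B2}" "y \<notin> halves {A, B1, B2}"
  using base_subset assms by (auto simp: halves_def)

lemma marker_ends:
  "hd (us @ [m1]) \<in> X \<union> {m1, m2} - {A, B1, B2}" "hd (vs @ [m2]) \<in> X \<union> {m1, m2} - {A, B1, B2}"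
  "m1 \<notin> {A, B1, B2}" "m2 \<notin> {A, B1, B2}"
proof -
  have "set (us @ [m1]) \<subseteq> X \<union> {m1, m2} - {A, B1, B2}" "set (vs @ [m2]) \<subseteq> X \<union> {m1, m2} - {A, B1, B2}"
    using distinct X markers by auto
  then show "hd (us @ [m1]) \<in> X \<union> {m1, m2} - {A, B1, B2}" "hd (vs @ [m2]) \<in> X \<union> {m1, m2} - {A, B1, B2}"
    by (meson hd_in_set snoc_eq_iff_butlast subsetD)+
  show "m1 \<notin> {A, B1, B2}" "m2 \<notin> {A, B1, B2}"
    using X markers by auto
qed

lemma strands: "strands W (rest \<sigma>) (Entering B1) (Leaving B1) (Entering B2) (Leaving B2)
    (Entering A) (Leaving A) p (Leaving m1) r (Leaving m2)"
proof
  have "A \<in> X" "A \<notin> {B1, B2}" using distinct X by auto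
  then show "{Entering A, Leaving A, p, Leaving m1, r, Leaving m2} \<subseteq>
      W - {Entering B1, Leaving B1, Entering B2, Leaving B2}"
    using marker_ends by simp
  show "distinct [Entering B1, Leaving B1, Entering B2, Leaving B2]"
    using distinct by auto
  show "Field (rest \<sigma>) \<inter> {Entering B1, Leaving B1, Entering B2, Leaving B2} = {}"
  proof -
    have "x \<notin> halves {B1, B2} \<and> y \<notin> halves {B1, B2}" if "(x, y) \<in> rest \<sigma>" for x y
    proof (cases "(x, y) \<in> base")
      case True
      then show ?thesis using base_avoids[OF True] by (auto simp: halves_def)
    next
      case False
      then have "x \<in> halves Y" "y \<in> halves Y"
        using that pairing_subset[of Y c \<sigma>] by (auto simp: rest_def)
      then show ?thesis by (auto simp: halves_def)
    qed
    then show ?thesis unfolding Field_def halves_def by blast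
  qed
qed

lemma strands_a_phi:
  assumes "\<sigma> (c A) = Phi"
  shows "strands_a_phi W (rest \<sigma>) (Entering B1) (Leaving B1) (Entering B2) (Leaving B2)
    (Entering A) (Leaving A) p (Leaving m1) r (Leaving m2)
    (base \<union> (pairing Y c \<sigma> - {(Entering A, Leaving A)}))"
proof (intro strands_a_phi.intro strands strands_a_phi_axioms.intro)
  have A: "A \<in> Y" using X distinct by auto
  then show "rest \<sigma> = insert (Entering A, Leaving A) (base \<union> (pairing Y c \<sigma> - {(Entering A, Leaving A)}))"
    using assms by (auto simp: rest_def)
  have "(x, y) \<in> pairing Y c \<sigma> - {(Entering A, Leaving A)} \<Longrightarrow>
      x \<notin> {Entering A, Leaving A} \<and> y \<notin> {Entering A, Leaving A}" for x y
    using assms by (cases x; cases y) (auto split: if_splits)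
  then show "Field (base \<union> (pairing Y c \<sigma> - {(Entering A, Leaving A)})) \<inter> {Entering A, Leaving A} = {}"
    using base_avoids unfolding Field_def halves_def by blast
  show "{p, Leaving m1, r, Leaving m2} \<inter> {Entering A, Leaving A} = {}"
    using marker_ends by simp
qed simp

lemma circles_phi:
  assumes "\<sigma> (c B1) = Phi \<or> \<sigma> (c A) = Phi"
  shows "kC \<sigma> = kC' \<sigma>" "kD \<sigma> = kD' \<sigma>"
proof -
  interpret strands W "rest \<sigma>" "Entering B1" "Leaving B1" "Entering B2" "Leaving B2"
    "Entering A" "Leaving A" p "Leaving m1" r "Leaving m2"
    by (rule strands)
  have "kC \<sigma> = kC' \<sigma> \<and> kD \<sigma> = kD' \<sigma>"
  proof (cases "\<sigma> (c B1) = Phi")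
    case True
    then show ?thesis unfolding circles_expand by (simp only: b_part.simps phi)
  next
    case False
    with assms have "\<sigma> (c A) = Phi" by simp
    note a_phi = strands_a_phi.a_phi[OF strands_a_phi[of \<sigma>, OF this], of "b_part (\<sigma> (c B1))"]
    have "b_part (\<sigma> (c B1)) \<in> {b_phi, b_chi, b_psi}"
      by (cases "\<sigma> (c B1)") auto
    then show ?thesis unfolding circles_expand using a_phi by blast
  qed
  then show "kC \<sigma> = kC' \<sigma>" "kD \<sigma> = kD' \<sigma>" by auto
qed

lemma circles_chi:
  assumes "\<sigma> (c B1) = Chi"
  shows "kC \<sigma> = kD \<sigma>" "kC' \<sigma> = kD' \<sigma>"
proof -
  interpret strands W "rest \<sigma>" "Entering B1" "Leaving B1" "Entering B2" "Leaving B2"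
    "Entering A" "Leaving A" p "Leaving m1" r "Leaving m2"
    by (rule strands)
  show "kC \<sigma> = kD \<sigma>" "kC' \<sigma> = kD' \<sigma>"
    unfolding circles_expand assms by (simp_all only: b_part.simps chi)
qed

lemma rest_flip:
  defines "\<pi> \<equiv> (\<lambda>h. if h = Entering A then Leaving A else if h = Leaving A then Entering A else h)"
  assumes "\<sigma> (c A) \<noteq> Phi" "(x, y) \<in> rest \<sigma>"
  shows "(\<pi> x, \<pi> y) \<in> rest (flip (c A) \<sigma>) \<union> (rest (flip (c A) \<sigma>))\<inverse>"
proof (cases "(x, y) \<in> base")
  case True
  then have "x \<notin> {Entering A, Leaving A}" "y \<notin> {Entering A, Leaving A}"
    using base_avoids[OF True] by auto
  then have "\<pi> x = x" "\<pi> y = y" by (auto simp: \<pi>_def)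
  with True show ?thesis by (simp add: rest_def)
next
  case False
  then have "(x, y) \<in> pairing Y c \<sigma>" using assms(3) by (simp add: rest_def)
  moreover have "{i \<in> Y. c i = c A} = {i \<in> X. c i = c A}"
    using chords_ab by auto
  then have "{i \<in> Y. c i = c A} = {A, A'}"
    using chord_a(1) by (rule trans)
  ultimately have "(\<pi> x, \<pi> y) \<in> pairing Y c (flip (c A) \<sigma>) \<union> (pairing Y c (flip (c A) \<sigma>))\<inverse>"
    unfolding \<pi>_def using pairing_flip[of Y c A A' \<sigma> x y] chord_a(2) assms(2) by blast
  then show ?thesis by (auto simp: rest_def)
qed

text \<open>Exchanging the half-edges at \<open>A\<close> carries \<open>E\<close> to
  \<open>E'\<close> up to direction: the strand from \<open>x1\<close> to \<open>x2\<close> now runs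
  through \<open>A\<close> the other way, and the strand from \<open>x3\<close> to \<open>x4\<close>
  does not meet \<open>A\<close>.\<close>

lemma comps_rest_flip:
  assumes \<sigma>: "\<sigma> (c A) \<noteq> Phi"
    and K: "Entering A \<in> K" "Leaving A \<in> K"
    and E: "E = {(x1, Entering A), (Leaving A, x2), (x3, x4)}"
      "E' = {(x2, Entering A), (x1, Leaving A), (x3, x4)}"
    and x: "{x1, x2, x3, x4} \<inter> {Entering A, Leaving A} = {}"
  shows "comps K (rest \<sigma> \<union> E) = comps K (rest (flip (c A) \<sigma>) \<union> E')"
proof (rule comps_swap[where a = "Entering A" and a' = "Leaving A"])
  have \<sigma>': "flip (c A) \<sigma> (c A) \<noteq> Phi" using \<sigma> by (simp add: flip_apply)
  let ?\<pi> = "\<lambda>h. if h = Entering A then Leaving A else if h = Leaving A then Entering A else h"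
  show "(?\<pi> x, ?\<pi> y) \<in> (rest (flip (c A) \<sigma>) \<union> E') \<union> (rest (flip (c A) \<sigma>) \<union> E')\<inverse>"
    if "(x, y) \<in> rest \<sigma> \<union> E" for x y
  proof (cases "(x, y) \<in> rest \<sigma>")
    case True
    then show ?thesis using rest_flip[OF \<sigma> True] by blast
  next
    case False
    with that have "(x, y) \<in> E" by blast
    then show ?thesis using x unfolding E by auto
  qed
  show "(?\<pi> x, ?\<pi> y) \<in> (rest \<sigma> \<union> E) \<union> (rest \<sigma> \<union> E)\<inverse>"
    if "(x, y) \<in> rest (flip (c A) \<sigma>) \<union> E'" for x y
  proof (cases "(x, y) \<in> rest (flip (c A) \<sigma>)")
    case True
    then show ?thesis using rest_flip[OF \<sigma>' True] unfolding flip_involution by blast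
  next
    case False
    with that have "(x, y) \<in> E'" by blast
    then show ?thesis using x unfolding E by auto
  qed
qed (fact K)+

lemma circles_psi:
  assumes b: "\<sigma> (c B1) = Psi" and a: "\<sigma> (c A) \<noteq> Phi"
  shows "kC \<sigma> = kD' (flip (c A) \<sigma>)" "kC' \<sigma> = kD (flip (c A) \<sigma>)"
proof -
  interpret S: strands W "rest \<sigma>" "Entering B1" "Leaving B1" "Entering B2" "Leaving B2"
    "Entering A" "Leaving A" p "Leaving m1" r "Leaving m2"
    by (rule strands)
  interpret S': strands W "rest (flip (c A) \<sigma>)" "Entering B1" "Leaving B1" "Entering B2" "Leaving B2"
    "Entering A" "Leaving A" p "Leaving m1" r "Leaving m2"
    by (rule strands)
  have b': "flip (c A) \<sigma> (c B1) = Psi" using b chords_ab by (simp add: flip_apply)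
  have hd: "hd (us @ [m1]) \<noteq> A" "hd (vs @ [m2]) \<noteq> A" "m1 \<noteq> A" "m2 \<noteq> A"
    using marker_ends by auto
  have K: "Entering A \<in> S.K" "Leaving A \<in> S.K"
    using S.V by auto
  have "comps S.K (rest \<sigma> \<union> {(Leaving m2, Entering A), (Leaving A, Leaving m1), (p, r)}) =
      comps S.K (rest (flip (c A) \<sigma>) \<union> {(Leaving m1, Entering A), (Leaving m2, Leaving A), (p, r)})"
    by (rule comps_rest_flip[of \<sigma>, OF a K refl refl]) (use hd in auto)
  then show "kC \<sigma> = kD' (flip (c A) \<sigma>)"
    unfolding circles_expand b b' by (simp only: b_part.simps S.psi S'.psi)
  have "comps S.K (rest \<sigma> \<union> {(r, Entering A), (Leaving A, p), (Leaving m2, Leaving m1)}) =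
      comps S.K (rest (flip (c A) \<sigma>) \<union> {(p, Entering A), (r, Leaving A), (Leaving m2, Leaving m1)})"
    by (rule comps_rest_flip[of \<sigma>, OF a K refl refl]) (use hd in auto)
  \<comment> \<open>Only the directions and the order of the edges are changed, to match the form in
    which \<open>psi\<close> lists them.\<close>
  moreover have "comps S.K (rest \<sigma> \<union> {(r, Entering A), (Leaving A, p), (Leaving m2, Leaving m1)}) =
      comps S.K (rest \<sigma> \<union> {(Leaving A, p), (Leaving m2, Leaving m1), (Entering A, r)})"
    by (rule comps_sym_cong) auto
  moreover have "comps S.K (rest (flip (c A) \<sigma>) \<union> {(p, Entering A), (r, Leaving A), (Leaving m2, Leaving m1)}) =
      comps S.K (rest (flip (c A) \<sigma>) \<union> {(Leaving A, r), (Leaving m2, Leaving m1), (p, Entering A)})"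
    by (rule comps_sym_cong) auto
  ultimately show "kC' \<sigma> = kD (flip (c A) \<sigma>)"
    unfolding circles_expand b b' by (simp only: b_part.simps S.psi S'.psi)
qed

lemma Z_four_term:
  "Z ([A, B1] @ us @ [B2] @ vs) c - Z ([B1, A] @ us @ [B2] @ vs) c
    - Z ([B1] @ us @ [B2, A] @ vs) c + Z ([B1] @ us @ [A, B2] @ vs) c = 0"
proof -
  let ?I = "c ` X \<rightarrow>\<^sub>E (UNIV :: ttype set)"
  let ?w = "state_weight (c ` X)"
  let ?x = "\<lambda>k. var_x ^ (k - 1)"
  define T where "T \<sigma> = ?w \<sigma> * (?x (kC \<sigma>) - ?x (kC' \<sigma>) - ?x (kD \<sigma>) + ?x (kD' \<sigma>))" for \<sigma>
  have A: "A \<in> X" and fin: "finite X" using X by auto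
  have sets: "set ([A, B1] @ us @ [B2] @ vs) = X" "set ([B1, A] @ us @ [B2] @ vs) = X"
    "set ([B1] @ us @ [B2, A] @ vs) = X" "set ([B1] @ us @ [A, B2] @ vs) = X"
    using X by auto
  \<comment> \<open>If a or b is \<phi>, or b is \<chi>, both summands vanish separately. If b is
    \<psi> and a is not \<phi>, the flip interchanges \<open>kC\<close> with \<open>kD'\<close> and
    \<open>kC'\<close> with \<open>kD\<close>, which leaves the bracket unchanged, while the weight
    changes sign.\<close>
  have cancel: "T \<sigma> + T (flip (c A) \<sigma>) = 0" for \<sigma>
  proof -
    let ?\<sigma> = "flip (c A) \<sigma>"
    have fb: "?\<sigma> (c B1) = \<sigma> (c B1)" and fa: "?\<sigma> (c A) = Phi \<longleftrightarrow> \<sigma> (c A) = Phi"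
      using chords_ab(2) by (auto simp: flip_apply)
    consider "\<sigma> (c B1) = Phi \<or> \<sigma> (c A) = Phi" | "\<sigma> (c B1) = Chi" | "\<sigma> (c B1) = Psi" "\<sigma> (c A) \<noteq> Phi"
      by (cases "\<sigma> (c B1)") auto
    then show ?thesis
    proof cases
      case 1
      then show ?thesis
        using circles_phi[of \<sigma>] circles_phi[of ?\<sigma>] fa fb by (simp only: T_def) simp
    next
      case 2
      then show ?thesis
        using circles_chi[of \<sigma>] circles_chi[of ?\<sigma>] fb by (simp only: T_def) simp
    next
      case 3
      have w: "?w ?\<sigma> = - ?w \<sigma>"
        by (rule state_weight_flip) (use fin A 3 in auto)
      have b': "?\<sigma> (c B1) = Psi" and a': "?\<sigma> (c A) \<noteq> Phi" using 3 fa fb by auto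
      show ?thesis
        unfolding T_def w circles_psi[OF 3] circles_psi[OF b' a', unfolded flip_involution]
        by (simp add: algebra_simps)
    qed
  qed
  \<comment> \<open>The flip is an involution on states, so summing over it doubles the sum. This
    avoids choosing representatives of its orbits; the factor 2 can be cancelled in the polynomial
    ring.\<close>
  have "(\<Sum>\<sigma>\<in>?I. T \<sigma>) = (\<Sum>\<sigma>\<in>?I. T (flip (c A) \<sigma>))"
    by (rule sum.reindex_bij_witness[of _ "flip (c A)" "flip (c A)"])
      (use A in \<open>auto simp: flip_apply PiE_def extensional_def\<close>)
  then have "2 * (\<Sum>\<sigma>\<in>?I. T \<sigma>) = (\<Sum>\<sigma>\<in>?I. T \<sigma> + T (flip (c A) \<sigma>))"
    by (simp add: sum.distrib)
  also have "\<dots> = 0" using cancel by simp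
  finally have "(\<Sum>\<sigma>\<in>?I. T \<sigma>) = 0" by simp
  then show ?thesis
    unfolding Z_def sets T_def
    by (simp add: sum.distrib sum_subtractf right_diff_distrib distrib_left)
qed

end

section \<open>From labelled ends back to words\<close>

lemma Q_four_term:
  assumes ab: "a \<noteq> b" and C: "chord_diagram ([a, b] @ u @ [b] @ v)"
  shows "Q ([a, b] @ u @ [b] @ v) - Q ([b, a] @ u @ [b] @ v)
    - Q ([b] @ u @ [b, a] @ v) + Q ([b] @ u @ [a, b] @ v) = 0"
proof -
  \<comment> \<open>All four words are read off from this single labelling, by permuting
    \<open>L\<close> and keeping \<open>c\<close>.\<close>
  obtain L and c :: "nat \<Rightarrow> nat" where L: "distinct L" "map c L = [a, b] @ u @ [b] @ v"
    by (rule word_labelling)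
  then obtain A B1 B2 us vs where L': "L = [A, B1] @ us @ [B2] @ vs"
    and c: "c A = a" "c B1 = b" "c B2 = b" "map c us = u" "map c vs = v"
    by (auto simp: map_eq_append_conv map_eq_Cons_conv)
  define X where "X = set L"
  have X: "X = set ([A, B1] @ us @ [B2] @ vs)" by (simp add: X_def L')
  have two: "two_ended c X"
    using C unfolding L(2)[symmetric] chord_diagram_two_ended[OF L(1)] X_def .
  have "card {i \<in> X. c i = c B1} = card {B1, B2}"
    using two L L' by (auto simp: two_ended_def X_def)
  moreover have "{B1, B2} \<subseteq> {i \<in> X. c i = c B1}" "finite {i \<in> X. c i = c B1}"
    using c X by auto
  ultimately have chord_b: "{i \<in> X. c i = c B1} = {B1, B2}"
    by (metis card_subset_eq)
  have "card {i \<in> X. c i = c A} = 2" "A \<in> {i \<in> X. c i = c A}"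
    using two X by (auto simp: two_ended_def)
  then obtain x y where xy: "{i \<in> X. c i = c A} = {x, y}" "x \<noteq> y" "A \<in> {x, y}"
    unfolding card_2_iff by blast
  obtain A' where chord_a: "{i \<in> X. c i = c A} = {A, A'}" "A \<noteq> A'"
  proof (cases "A = x")
    case True
    with xy show ?thesis by (intro that[of y]) simp_all
  next
    case False
    with xy show ?thesis by (intro that[of x]) (simp_all add: insert_commute)
  qed
  have "finite X" by (simp add: X_def)
  then obtain m1 where m1: "m1 \<notin> X" using ex_new_if_finite infinite_UNIV_nat by blast
  obtain m2 where m2: "m2 \<notin> insert m1 X"
    using \<open>finite X\<close> ex_new_if_finite[of "insert m1 X"] infinite_UNIV_nat by auto
  interpret four_ends A A' B1 B2 m1 m2 us vs c X
    by standard (use X L L' chord_a chord_b m1 m2 in auto)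
  have words: "[a, b] @ u @ [b] @ v = map c ([A, B1] @ us @ [B2] @ vs)"
    "[b, a] @ u @ [b] @ v = map c ([B1, A] @ us @ [B2] @ vs)"
    "[b] @ u @ [b, a] @ v = map c ([B1] @ us @ [B2, A] @ vs)"
    "[b] @ u @ [a, b] @ v = map c ([B1] @ us @ [A, B2] @ vs)"
    using c by auto
  have Q: "Q (map c L') = Z L' c" if "distinct L'" "set L' = X" for L'
    by (rule Q_eq_Z) (use that chord_diagram_two_ended two in auto)
  show ?thesis
    unfolding words using Z_four_term
    by (subst (1 2 3 4) Q) (use distinct X in auto)
qed

text \<open>The case where A follows is the case where it precedes with the two diagrams of each
  pair exchanged, so its relation is the negative of the other one.\<close>

lemma Q_four_term_relations:
  assumes "four_term C C' D D'"
  shows "Q C - Q C' - Q D + Q D' = 0"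
  using assms
proof cases
  case (precedes a b u v)
  then show ?thesis using Q_four_term by simp
next
  case (follows a b u v)
  have "count_list ([a, b] @ w) = count_list ([b, a] @ w)" "set ([a, b] @ w) = set ([b, a] @ w)" for w
    by (auto simp: fun_eq_iff)
  then have "chord_diagram ([a, b] @ u @ [b] @ v)"
    using follows unfolding chord_diagram_def by (metis (no_types, lifting))
  then show ?thesis
    using Q_four_term[of a b u v] follows by (simp add: algebra_simps)
qed

theorem theorem2p1:
  "weight_system Q \<and>
   (\<forall>C1 C2 C. chord_diagram C1 \<longrightarrow> chord_diagram C2 \<longrightarrow> is_product C1 C2 C \<longrightarrow>
      Q C = Q C1 * Q C2)"
  unfolding weight_system_def
  using Q_iso Q_four_term_relations Q_product by blast

end
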